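(* Let $n\ge 2$ and let $\varphi:\Delta_n\to\mathbb{R}$ be a smooth exponentially concave function such that the Euclidean Hessian of $e^{\varphi}$ is strictly negative definite everywhere on $\Delta_n$. Then $\Delta_n$ equipped with the geometric structure $(g,\nabla,\nabla^* )$ induced by the L-divergence of $\varphi$ is dually projectively flat, but it is not flat for $n\ge 3$ (that is, for $n\geq 3$ the Riemann-Christoffel curvature tensors of $\nabla$ and $\nabla^*$ do not vanish).
   Context: $\Delta_n=\{p\in\mathbb{R}^n: p_i>0,\ \sum_{i=1}^n p_i=1\}$, a smooth $(n-1)$-dimensional manifold. $\nabla\varphi(p)\cdot v$ denotes the directional derivative of $\varphi$ at $p$ along $v\in\mathbb{R}^n$ with $\sum_i v_i=0$; definiteness of the Hessian is with respect to nonzero such $v$. $\varphi$ is exponentially concave if $e^{\varphi}$ is concave. L-divergence: $T(q\mid p)=\log(1+\nabla\varphi(p)\cdot(q-p))-(\varphi(q)-\varphi(p))$. Geometric structure: in any coordinate system $\xi$ of $\Delta_n$, $g_{ij}(\xi)=-\partial_{\xi_i}\partial_{\xi'_j}T(\xi\mid\xi')|_{\xi=\xi'}$; primal connection $\nabla$: $\Gamma_{ijk}(\xi)=-\partial_{\xi_i}\partial_{\xi_j}\partial_{\xi'_k}T(\xi\mid\xi')|_{\xi=\xi'}$; dual connection $\nabla^*$: $\Gamma^*_{ijk}(\xi)=-\partial_{\xi_k}\partial_{\xi'_i}\partial_{\xi'_j}T(\xi\mid\xi')|_{\xi=\xi'}$; $\Gamma_{ij}^k=\sum_m\Gamma_{ijm}g^{mk}$,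 $\Gamma_{ij}^{*k}=\sum_m\Gamma^*_{ijm}g^{mk}$ with $(g^{ij})=(g_{ij})^{-1}$. Geodesics of $\nabla$ (resp. $\nabla^*$) are the solutions of $\ddot\xi_k+\sum_{i,j}\Gamma_{ij}^k\dot\xi_i\dot\xi_j=0$ (resp. with $\Gamma_{ij}^{*k}$). A connection is projectively flat if there is a coordinate system under which its geodesics are straight lines up to time reparameterizations. $(g,\nabla,\nabla^* )$ is dually projectively flat if both $\nabla$ and $\nabla^*$ are projectively flat. The Riemann-Christoffel curvature tensor of a connection is $R(X,Y)Z=\nabla_X\nabla_YZ-\nabla_Y\nabla_XZ-\nabla_{[X,Y]}Z$. *)

theory Defs
  imports "HOL-Analysis.Analysis"
begin

section \<open>Smooth functions and directional derivatives\<close>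

primrec Ck_on :: "nat \<Rightarrow> 'a::real_normed_vector set \<Rightarrow> ('a \<Rightarrow> 'b::real_normed_vector) \<Rightarrow> bool"
  where
    "Ck_on 0 S f \<longleftrightarrow> continuous_on S f"
  | "Ck_on (Suc k) S f \<longleftrightarrow>
       (\<forall>x\<in>S. f differentiable (at x)) \<and>
       (\<forall>v. Ck_on k S (\<lambda>x. frechet_derivative f (at x) v))"

text \<open>Smoothness on an arbitrary subset of a Euclidean space, via a smooth extension to an open
  neighbourhood. On open sets this is ordinary smoothness; on the open simplex, which is an embedded
  submanifold, it is smoothness in the sense of manifolds.\<close>

definition smooth_on :: "'a::real_normed_vector set \<Rightarrow> ('a \<Rightarrow> 'b::real_normed_vector) \<Rightarrow> bool"
  where "smooth_on S f \<longleftrightarrow>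
    (\<exists>W F. open W \<and> S \<subseteq> W \<and> (\<forall>k. Ck_on k W F) \<and> (\<forall>x\<in>S. F x = f x))"

text \<open>For a function given on the simplex only, this is meaningful for directions \<open>v\<close> with
  \<open>(\<Sum>i\<in>UNIV. v $ i) = 0\<close>: the line then stays in the simplex for small \<open>t\<close>.\<close>

definition dir_deriv :: "('a::real_vector \<Rightarrow> real) \<Rightarrow> 'a \<Rightarrow> 'a \<Rightarrow> real"
  where "dir_deriv f p v = deriv (\<lambda>t. f (p + t *\<^sub>R v)) 0"

definition hessian :: "('a::real_vector \<Rightarrow> real) \<Rightarrow> 'a \<Rightarrow> 'a \<Rightarrow> 'a \<Rightarrow> real"
  where "hessian f p u v = dir_deriv (\<lambda>q. dir_deriv f q v) p u"

definition partial_deriv :: "'m::finite \<Rightarrow> (real^'m \<Rightarrow> real) \<Rightarrow> real^'m \<Rightarrow> real"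
  where "partial_deriv i f x = dir_deriv f x (axis i 1)"


section \<open>The simplex, exponential concavity and the L-divergence\<close>

definition open_simplex :: "(real^'n) set"
  where "open_simplex = {p. (\<forall>i. p $ i > 0) \<and> (\<Sum>i\<in>UNIV. p $ i) = 1}"

definition exponentially_concave :: "(real^'n \<Rightarrow> real) \<Rightarrow> bool"
  where "exponentially_concave \<phi> \<longleftrightarrow> concave_on open_simplex (\<lambda>p. exp (\<phi> p))"

definition hessian_negative_definite :: "(real^'n \<Rightarrow> real) \<Rightarrow> bool"
  where "hessian_negative_definite f \<longleftrightarrow>
    (\<forall>p\<in>open_simplex. \<forall>v. v \<noteq> 0 \<and> (\<Sum>i\<in>UNIV. v $ i) = 0 \<longrightarrow> hessian f p v v < 0)"

definition L_divergence :: "(real^'n \<Rightarrow> real) \<Rightarrow> real^'n \<Rightarrow> real^'n \<Rightarrow> real"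
  where "L_divergence \<phi> q p = ln (1 + dir_deriv \<phi> p (q - p)) - (\<phi> q - \<phi> p)"


section \<open>Coordinate systems and the induced geometric structure\<close>

text \<open>A coordinate system is a diffeomorphism of the simplex onto an open subset of
  \<open>real^'m\<close>; the intended dimension, \<open>CARD('n) = CARD('m) + 1\<close>, is a hypothesis of
  the theorem.\<close>

definition coordinate_system :: "(real^'n \<Rightarrow> real^'m) \<Rightarrow> bool"
  where "coordinate_system \<xi> \<longleftrightarrow>
    inj_on \<xi> open_simplex \<and> open (\<xi> ` open_simplex) \<and>
    smooth_on open_simplex \<xi> \<and>
    smooth_on (\<xi> ` open_simplex) (inv_into open_simplex \<xi>)"

definition coord_divergence ::
    "(real^'n \<Rightarrow> real) \<Rightarrow> (real^'n \<Rightarrow> real^'m) \<Rightarrow> real^'m \<Rightarrow> real^'m \<Rightarrow> real"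
  where "coord_divergence \<phi> \<xi> x x' =
    L_divergence \<phi> (inv_into open_simplex \<xi> x) (inv_into open_simplex \<xi> x')"

text \<open>Metrics and connections are given by their components in each coordinate system: for a
  coordinate system \<open>\<xi>\<close> and a point \<open>x\<close> of its range, \<open>g \<xi> x i j\<close> is
  $g_{ij}(x)$ and \<open>D \<xi> x i j k\<close> is the Christoffel symbol $\Gamma_{ij}^k(x)$.\<close>

type_synonym ('n, 'm) metric_field = "(real^'n \<Rightarrow> real^'m) \<Rightarrow> real^'m \<Rightarrow> 'm \<Rightarrow> 'm \<Rightarrow> real"
type_synonym 'm christoffel = "real^'m \<Rightarrow> 'm \<Rightarrow> 'm \<Rightarrow> 'm \<Rightarrow> real"
type_synonym ('n, 'm) connection = "(real^'n \<Rightarrow> real^'m) \<Rightarrow> 'm christoffel"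

definition L_metric :: "(real^'n \<Rightarrow> real) \<Rightarrow> ('n, 'm::finite) metric_field"
  where "L_metric \<phi> \<xi> x i j =
    - partial_deriv i (\<lambda>y. partial_deriv j (\<lambda>y'. coord_divergence \<phi> \<xi> y y') x) x"

definition inverse_metric :: "(real^'n \<Rightarrow> real) \<Rightarrow> ('n, 'm::finite) metric_field"
  where "inverse_metric \<phi> \<xi> x i j = matrix_inv (\<chi> a b. L_metric \<phi> \<xi> x a b) $ i $ j"

text \<open>The symbols with lowered index: $-\partial_i \partial_j \partial'_k T$ and
  $-\partial_k \partial'_i \partial'_j T$ on the diagonal, where a prime marks differentiation in
  the second argument.\<close>

definition primal_lower :: "(real^'n \<Rightarrow> real) \<Rightarrow> ('n, 'm::finite) connection"
  where "primal_lower \<phi> \<xi> x i j k =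
    - partial_deriv i (\<lambda>y. partial_deriv j (\<lambda>z.
        partial_deriv k (\<lambda>y'. coord_divergence \<phi> \<xi> z y') x) y) x"

definition dual_lower :: "(real^'n \<Rightarrow> real) \<Rightarrow> ('n, 'm::finite) connection"
  where "dual_lower \<phi> \<xi> x i j k =
    - partial_deriv k (\<lambda>y. partial_deriv i (\<lambda>y'.
        partial_deriv j (\<lambda>z'. coord_divergence \<phi> \<xi> y z') y') x) x"

definition primal_connection :: "(real^'n \<Rightarrow> real) \<Rightarrow> ('n, 'm::finite) connection"
  where "primal_connection \<phi> \<xi> x i j k =
    (\<Sum>m\<in>UNIV. primal_lower \<phi> \<xi> x i j m * inverse_metric \<phi> \<xi> x m k)"

definition dual_connection :: "(real^'n \<Rightarrow> real) \<Rightarrow> ('n, 'm::finite) connection"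
  where "dual_connection \<phi> \<xi> x i j k =
    (\<Sum>m\<in>UNIV. dual_lower \<phi> \<xi> x i j m * inverse_metric \<phi> \<xi> x m k)"


section \<open>Geodesics and projective flatness\<close>

definition geodesic ::
    "(real^'m) set \<Rightarrow> 'm::finite christoffel \<Rightarrow> real set \<Rightarrow> (real \<Rightarrow> real^'m) \<Rightarrow> bool"
  where "geodesic U \<Gamma> J \<gamma> \<longleftrightarrow>
    open J \<and> is_interval J \<and> \<gamma> ` J \<subseteq> U \<and>
    (\<exists>\<gamma>' \<gamma>''. \<forall>t\<in>J.
       (\<gamma> has_vector_derivative \<gamma>' t) (at t) \<and>
       (\<gamma>' has_vector_derivative \<gamma>'' t) (at t) \<and>
       (\<forall>k. \<gamma>'' t $ k +
          (\<Sum>i\<in>UNIV. \<Sum>j\<in>UNIV. \<Gamma> (\<gamma> t) i j k * \<gamma>' t $ i * \<gamma>' t $ j) = 0))"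

text \<open>The time change \<open>s\<close> has a positive derivative; \<open>v = 0\<close> occurs exactly
  for constant curves, which always solve the geodesic equation.\<close>

definition straight_up_to_time :: "real set \<Rightarrow> (real \<Rightarrow> real^'m) \<Rightarrow> bool"
  where "straight_up_to_time J \<gamma> \<longleftrightarrow>
    (\<exists>a v s. \<forall>t\<in>J. (\<exists>d>0. (s has_real_derivative d) (at t)) \<and> \<gamma> t = a + s t *\<^sub>R v)"

definition projectively_flat :: "('n::finite, 'm::finite) connection \<Rightarrow> bool"
  where "projectively_flat D \<longleftrightarrow>
    (\<exists>\<xi>. coordinate_system \<xi> \<and>
       (\<forall>J \<gamma>. geodesic (\<xi> ` open_simplex) (D \<xi>) J \<gamma> \<longrightarrow> straight_up_to_time J \<gamma>))"

definition dually_projectively_flat ::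
    "('n::finite, 'm::finite) metric_field \<Rightarrow> ('n, 'm) connection \<Rightarrow> ('n, 'm) connection \<Rightarrow> bool"
  where "dually_projectively_flat g D D' \<longleftrightarrow> projectively_flat D \<and> projectively_flat D'"


section \<open>Curvature\<close>

text \<open>Vector fields are given by their components in the coordinate system at hand.\<close>

definition covariant_deriv ::
    "'m::finite christoffel \<Rightarrow> (real^'m \<Rightarrow> real^'m) \<Rightarrow> (real^'m \<Rightarrow> real^'m) \<Rightarrow> real^'m \<Rightarrow> real^'m"
  where "covariant_deriv \<Gamma> X Y x =
    (\<chi> k. (\<Sum>i\<in>UNIV. X x $ i * partial_deriv i (\<lambda>y. Y y $ k) x) +
          (\<Sum>i\<in>UNIV. \<Sum>j\<in>UNIV. \<Gamma> x i j k * X x $ i * Y x $ j))"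

definition lie_bracket ::
    "(real^'m::finite \<Rightarrow> real^'m) \<Rightarrow> (real^'m \<Rightarrow> real^'m) \<Rightarrow> real^'m \<Rightarrow> real^'m"
  where "lie_bracket X Y x =
    (\<chi> k. \<Sum>i\<in>UNIV. X x $ i * partial_deriv i (\<lambda>y. Y y $ k) x -
                   Y x $ i * partial_deriv i (\<lambda>y. X y $ k) x)"

definition curvature ::
    "'m::finite christoffel \<Rightarrow> (real^'m \<Rightarrow> real^'m) \<Rightarrow> (real^'m \<Rightarrow> real^'m) \<Rightarrow>
     (real^'m \<Rightarrow> real^'m) \<Rightarrow> real^'m \<Rightarrow> real^'m"
  where "curvature \<Gamma> X Y Z x =
    covariant_deriv \<Gamma> X (covariant_deriv \<Gamma> Y Z) x -
    covariant_deriv \<Gamma> Y (covariant_deriv \<Gamma> X Z) x -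
    covariant_deriv \<Gamma> (lie_bracket X Y) Z x"

definition curvature_vanishes :: "(real^'m) set \<Rightarrow> 'm::finite christoffel \<Rightarrow> bool"
  where "curvature_vanishes U \<Gamma> \<longleftrightarrow>
    (\<forall>X Y Z. smooth_on U X \<and> smooth_on U Y \<and> smooth_on U Z \<longrightarrow>
       (\<forall>x\<in>U. curvature \<Gamma> X Y Z x = 0))"

end

theory Submission
  imports Defs
begin

text \<open>
  Let \<open>\<Phi> = exp \<circ> \<phi>\<close>, and let \<open>w(p) \<in> \<real>\<^sup>n\<close> be the vector of values at the vertices of the simplex of the
  affine function tangent to \<open>\<Phi>\<close> at \<open>p\<close>. With \<open>r(q) = q / \<Phi>(q)\<close> the L-divergence becomes
  \<open>T(q | p) = ln (w(p) \<bullet> r(q))\<close>, an expression in which the two arguments play the same role. The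
  maps \<open>r\<close> and \<open>w\<close> are immersions of the simplex as centroaffine hypersurfaces of \<open>\<real>\<^sup>n\<close>, each the
  conormal map of the other: \<open>w \<bullet> r = 1\<close> and \<open>w \<bullet> dr = 0 = dw \<bullet> r\<close>. The locale \<open>conormal_pair\<close>
  captures this situation in an arbitrary chart.

  Differentiating the logarithm on the diagonal gives \<open>g\<^sub>i\<^sub>j = - \<partial>\<^sub>j w \<bullet> \<partial>\<^sub>i r\<close>,
  \<open>\<Gamma>\<^sub>i\<^sub>j\<^sub>k = - \<partial>\<^sub>k w \<bullet> \<partial>\<^sub>i \<partial>\<^sub>j r\<close> and \<open>\<Gamma>\<^sup>*\<^sub>i\<^sub>j\<^sub>k = - \<partial>\<^sub>i \<partial>\<^sub>j w \<bullet> \<partial>\<^sub>k r\<close>, because every term containing a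
  factor \<open>w \<bullet> \<partial>r\<close> or \<open>\<partial>w \<bullet> r\<close> vanishes there. So interchanging \<open>r\<close> and \<open>w\<close> interchanges the primal and
  the dual connection, and only one of them has to be studied. As \<open>w, \<partial>\<^sub>1 w, \<dots>\<close> span \<open>\<real>\<^sup>n\<close>, these formulas
  say precisely that \<open>\<nabla>\<close> is the connection induced on the hypersurface \<open>r\<close> by the transversal field
  \<open>r\<close> itself: \<open>\<partial>\<^sub>i \<partial>\<^sub>j r = \<Sum>\<^sub>k \<Gamma>\<^sub>i\<^sub>j\<^sup>k \<partial>\<^sub>k r + g\<^sub>i\<^sub>j r\<close> (lemma \<open>gauss\<close>). Both assertions follow from this
  equation.

  Projective flatness: along a geodesic \<open>r\<close> satisfies \<open>r'' = \<kappa> r\<close>, so that \<open>r\<close> stays in a plane through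
  the origin, and its central projection to the hyperplane of coordinate sum 1 is a straight line
  (\<open>geodesic_straight\<close>). The coordinates that straighten the geodesics are therefore the central
  projections of \<open>r\<close> and of \<open>w\<close>. For \<open>r\<close> this is the point of the simplex itself. For \<open>w\<close> it is the
  normalised tangent function, which determines the point by strict concavity of \<open>\<Phi>\<close>; it is a
  coordinate system by invariance of domain and the formula for the derivative of an inverse map.

  Curvature: equality of the mixed third derivatives of \<open>r\<close>, read off with the Gauss equation, gives
  \<open>R(X,Y)Z = g(X,Z) Y - g(Y,Z) X\<close>, which is nonzero if \<open>X\<close> and \<open>Y\<close> are independent and \<open>Z = Y\<close>
  (\<open>third_derivative\<close>, \<open>curvature_components_nonzero\<close>).
\<close>

section \<open>Calculus of smooth maps\<close>

abbreviation fderiv :: "('a::real_normed_vector \<Rightarrow> 'b::real_normed_vector) \<Rightarrow> 'a \<Rightarrow> 'a \<Rightarrow> 'b"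
  where "fderiv f x v \<equiv> frechet_derivative f (at x) v"

text \<open>Unlike \<^const>\<open>smooth_on\<close>, this uses the derivatives of the map itself and not those of an extension,
so it is of use on open sets only, where the two notions agree (\<open>smooth_on_open_iff\<close> below).\<close>

definition Cinf_on :: "'a::real_normed_vector set \<Rightarrow> ('a \<Rightarrow> 'b::real_normed_vector) \<Rightarrow> bool"
  where "Cinf_on S f \<longleftrightarrow> (\<forall>k. Ck_on k S f)"

lemma fderiv_eq: "(f has_derivative f') (at x) \<Longrightarrow> fderiv f x = f'"
  using frechet_derivative_at by metis

text \<open>Openness of the set is essential: only then is the total derivative determined by the values on
the set.\<close>

lemma Ck_on_cong:
  assumes "open S" "\<And>x. x \<in> S \<Longrightarrow> f x = g x" "Ck_on k S f"
  shows "Ck_on k S g"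
  using assms(2,3)
proof (induction k arbitrary: f g)
  case 0
  then show ?case by (simp cong: continuous_on_cong)
next
  case (Suc k)
  have d: "(g has_derivative fderiv f x) (at x)" if "x \<in> S" for x
    using that Suc.prems assms(1)
    by (metis Ck_on.simps(2) frechet_derivative_works has_derivative_transform_within_open)
  have "Ck_on k S (\<lambda>x. fderiv g x v)" for v
    by (rule Suc.IH[of "\<lambda>x. fderiv f x v"]) (use Suc.prems d fderiv_eq in \<open>force+\<close>)
  then show ?case using d by (auto simp: differentiable_def)
qed

text \<open>The way to verify differentiability classes: any explicit formula for the derivative may replace
\<^const>\<open>frechet_derivative\<close>. The closure properties below are all proved by induction on the order
with this rule.\<close>

lemma Ck_on_SucI:
  assumes "open S" "\<And>x. x \<in> S \<Longrightarrow> (f has_derivative f' x) (at x)"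
    and "\<And>v. Ck_on k S (\<lambda>x. f' x v)"
  shows "Ck_on (Suc k) S f"
proof -
  have "Ck_on k S (\<lambda>x. fderiv f x v)" for v
    by (rule Ck_on_cong[OF assms(1) _ assms(3)[of v]]) (use assms(2) fderiv_eq in force)
  then show ?thesis using assms(2) by (auto simp: differentiable_def)
qed

lemma Ck_on_SucD:
  assumes "Ck_on (Suc k) S f"
  shows "x \<in> S \<Longrightarrow> (f has_derivative fderiv f x) (at x)" "Ck_on k S (\<lambda>x. fderiv f x v)"
  using assms by (auto simp: frechet_derivative_works)

lemma Ck_on_lower: "Ck_on (Suc k) S f \<Longrightarrow> Ck_on k S f"
proof (induction k arbitrary: f)
  case 0
  then show ?case
    by (auto intro!: continuous_at_imp_continuous_on differentiable_imp_continuous_within)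
qed simp

lemma Ck_on_subset: "Ck_on k S f \<Longrightarrow> T \<subseteq> S \<Longrightarrow> Ck_on k T f"
  by (induction k arbitrary: f) (auto intro: continuous_on_subset)

lemma Ck_on_const: "open S \<Longrightarrow> Ck_on k S (\<lambda>x. c)"
  by (induction k arbitrary: c)
    (auto intro: Ck_on_SucI[where f'="\<lambda>x v. 0"] simp del: Ck_on.simps(2))

lemma Ck_on_linear:
  assumes "bounded_linear L" "open S" "Ck_on k S f"
  shows "Ck_on k S (\<lambda>x. L (f x))"
  using assms(3)
proof (induction k arbitrary: f)
  case 0
  then show ?case using assms(1) by (simp add: bounded_linear.continuous_on)
next
  case (Suc k)
  note D = Ck_on_SucD[OF Suc.prems]
  show ?case
    by (rule Ck_on_SucI[OF assms(2) bounded_linear.has_derivative[OF assms(1) D(1)] Suc.IH[OF D(2)]])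
qed

lemma Ck_on_add:
  assumes "open S" "Ck_on k S f" "Ck_on k S g"
  shows "Ck_on k S (\<lambda>x. f x + g x)"
  using assms(2,3)
proof (induction k arbitrary: f g)
  case 0
  then show ?case by (simp add: continuous_on_add)
next
  case (Suc k)
  show ?case
    by (rule Ck_on_SucI[OF assms(1), where f'="\<lambda>x v. fderiv f x v + fderiv g x v"])
      (use Suc Ck_on_SucD[OF Suc.prems(1)] Ck_on_SucD[OF Suc.prems(2)] in \<open>auto intro: has_derivative_add\<close>)
qed

lemma Ck_on_sum:
  assumes "open S" "\<And>i. i \<in> I \<Longrightarrow> Ck_on k S (f i)"
  shows "Ck_on k S (\<lambda>x. \<Sum>i\<in>I. f i x)"
  using assms(2)
  by (induction I rule: infinite_finite_induct)
    (simp_all add: Ck_on_const[OF assms(1)] Ck_on_add[OF assms(1)])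

lemma Ck_on_bilinear:
  assumes "bounded_bilinear B" "open S" "Ck_on k S f" "Ck_on k S g"
  shows "Ck_on k S (\<lambda>x. B (f x) (g x))"
  using assms(3,4)
proof (induction k arbitrary: f g)
  case 0
  then show ?case using bounded_bilinear.continuous_on[OF assms(1)] by simp
next
  case (Suc k)
  note D = Ck_on_SucD[OF Suc.prems(1)] Ck_on_SucD[OF Suc.prems(2)]
  show ?case
  proof (rule Ck_on_SucI[OF assms(2)])
    show "((\<lambda>x. B (f x) (g x)) has_derivative
        (\<lambda>v. B (f x) (fderiv g x v) + B (fderiv f x v) (g x))) (at x)" if "x \<in> S" for x
      using bounded_bilinear.FDERIV[OF assms(1)] D that by blast
    show "Ck_on k S (\<lambda>x. B (f x) (fderiv g x v) + B (fderiv f x v) (g x))" for v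
      by (intro Ck_on_add assms(2) Suc.IH D Ck_on_lower[OF Suc.prems(1)] Ck_on_lower[OF Suc.prems(2)])
  qed
qed

text \<open>The chain rule expresses the derivative of the composition through the derivative of \<open>f\<close> in an
arbitrary direction. Expanding that direction in a basis turns it into a sum of products to which
the induction hypothesis applies; this is where finite dimension enters.\<close>

lemma Ck_on_compose:
  fixes g :: "'a::real_normed_vector \<Rightarrow> 'b::euclidean_space"
  assumes "open S" "Ck_on k T f" "Ck_on k S g" "g ` S \<subseteq> T"
  shows "Ck_on k S (\<lambda>x. f (g x))"
  using assms(2,3)
proof (induction k arbitrary: f)
  case 0
  then show ?case using assms(4) by (auto intro: continuous_on_compose2)
next
  case (Suc k)
  note D = Ck_on_SucD[OF Suc.prems(1)] Ck_on_SucD[OF Suc.prems(2)]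
  have eq: "fderiv f (g x) u = (\<Sum>b\<in>Basis. (u \<bullet> b) *\<^sub>R fderiv f (g x) b)" if "x \<in> S" for x u
  proof -
    have "linear (fderiv f (g x))"
      using D(1) that assms(4) has_derivative_linear by blast
    then have "(\<Sum>b\<in>Basis. (u \<bullet> b) *\<^sub>R fderiv f (g x) b) = fderiv f (g x) (\<Sum>b\<in>Basis. (u \<bullet> b) *\<^sub>R b)"
      by (simp add: linear_sum linear_cmul)
    then show ?thesis by (simp add: euclidean_representation)
  qed
  show ?case
  proof (rule Ck_on_SucI[OF assms(1)])
    show "((\<lambda>x. f (g x)) has_derivative (\<lambda>v. \<Sum>b\<in>Basis. (fderiv g x v \<bullet> b) *\<^sub>R fderiv f (g x) b)) (at x)"
      if "x \<in> S" for x
    proof -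
      have "((\<lambda>x. f (g x)) has_derivative (\<lambda>v. fderiv f (g x) (fderiv g x v))) (at x)"
        using has_derivative_compose[of g "fderiv g x" x UNIV f "fderiv f (g x)"] D that assms(4)
        by blast
      also have "(\<lambda>v. fderiv f (g x) (fderiv g x v)) =
          (\<lambda>v. \<Sum>b\<in>Basis. (fderiv g x v \<bullet> b) *\<^sub>R fderiv f (g x) b)"
        by (rule ext) (rule eq[OF that])
      finally show ?thesis .
    qed
    have "Ck_on k S (\<lambda>x. fderiv f (g x) b)" for b
      using Suc.IH[OF D(2)[of b]] Ck_on_lower[OF Suc.prems(2)] .
    then show "Ck_on k S (\<lambda>x. \<Sum>b\<in>Basis. (fderiv g x v \<bullet> b) *\<^sub>R fderiv f (g x) b)" for v
      by (intro Ck_on_sum Ck_on_bilinear[OF bounded_bilinear_scaleR]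
          Ck_on_linear[OF bounded_linear_inner_left] assms(1) D)
  qed
qed

lemma Ck_on_exp:
  fixes f :: "'a::real_normed_vector \<Rightarrow> real"
  assumes "open S" "Ck_on k S f"
  shows "Ck_on k S (\<lambda>x. exp (f x))"
  using assms(2)
proof (induction k)
  case 0
  then show ?case by (simp add: continuous_on_exp)
next
  case (Suc k)
  note D = Ck_on_SucD[OF Suc.prems]
  show ?case
  proof (rule Ck_on_SucI[OF assms(1)])
    show "((\<lambda>x. exp (f x)) has_derivative (\<lambda>v. exp (f x) * fderiv f x v)) (at x)" if "x \<in> S" for x
      using D(1)[OF that] by (auto intro!: derivative_eq_intros)
    show "Ck_on k S (\<lambda>x. exp (f x) * fderiv f x v)" for v
      by (intro Ck_on_bilinear[OF bounded_bilinear_mult] assms(1) D Suc.IH Ck_on_lower[OF Suc.prems])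
  qed
qed

lemma Ck_on_inverse:
  fixes f :: "'a::real_normed_vector \<Rightarrow> real"
  assumes "open S" "\<And>x. x \<in> S \<Longrightarrow> f x \<noteq> 0" "Ck_on k S f"
  shows "Ck_on k S (\<lambda>x. inverse (f x))"
  using assms(3)
proof (induction k)
  case 0
  then show ?case using assms(2) by (simp add: continuous_on_inverse)
next
  case (Suc k)
  note D = Ck_on_SucD[OF Suc.prems]
  show ?case
  proof (rule Ck_on_SucI[OF assms(1)])
    show "((\<lambda>x. inverse (f x)) has_derivative
        (\<lambda>v. - (inverse (f x) * fderiv f x v * inverse (f x)))) (at x)" if "x \<in> S" for x
      using D(1)[OF that] assms(2)[OF that] by (auto intro!: derivative_eq_intros)
    show "Ck_on k S (\<lambda>x. - (inverse (f x) * fderiv f x v * inverse (f x)))" for v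
      by (intro Ck_on_linear[OF bounded_linear_minus[OF bounded_linear_ident]]
          Ck_on_bilinear[OF bounded_bilinear_mult] assms(1) D Suc.IH Ck_on_lower[OF Suc.prems])
  qed
qed

lemma Ck_on_prod:
  fixes f :: "'i \<Rightarrow> 'a::real_normed_vector \<Rightarrow> real"
  assumes "open S" "\<And>i. i \<in> I \<Longrightarrow> Ck_on k S (f i)"
  shows "Ck_on k S (\<lambda>x. \<Prod>i\<in>I. f i x)"
  using assms(2)
  by (induction I rule: infinite_finite_induct)
    (simp_all add: Ck_on_const[OF assms(1)] Ck_on_bilinear[OF bounded_bilinear_mult assms(1)])

lemma Ck_on_vec_lambda:
  fixes f :: "'a::real_normed_vector \<Rightarrow> 'i::finite \<Rightarrow> real"
  assumes "open S" "\<And>i. Ck_on k S (\<lambda>x. f x i)"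
  shows "Ck_on k S (\<lambda>x. \<chi> i. f x i)"
proof -
  have "(\<lambda>x. \<chi> i. f x i) = (\<lambda>x. \<Sum>i\<in>UNIV. f x i *\<^sub>R axis i (1::real))"
    by (auto simp: vec_eq_iff axis_def if_distrib cong: if_cong)
  then show ?thesis
    by (auto intro!: Ck_on_sum Ck_on_linear[OF bounded_linear_scaleR_left] assms)
qed

lemma Ck_on_bounded_linear:
  assumes "bounded_linear L" "open S"
  shows "Ck_on k S L"
proof (cases k)
  case 0
  then show ?thesis using assms(1) by (simp add: linear_continuous_on)
next
  case (Suc l)
  then show ?thesis
    by (simp only:) (rule Ck_on_SucI[OF assms(2) bounded_linear_imp_has_derivative[OF assms(1)] Ck_on_const[OF assms(2)]])
qed

lemma Cinf_onD: "Cinf_on S f \<Longrightarrow> x \<in> S \<Longrightarrow> (f has_derivative fderiv f x) (at x)"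
  unfolding Cinf_on_def using Ck_on_SucD(1) by blast

lemma Cinf_on_fderiv: "Cinf_on S f \<Longrightarrow> Cinf_on S (\<lambda>x. fderiv f x v)"
  unfolding Cinf_on_def using Ck_on_SucD(2) by blast

lemma Cinf_on_cong: "open S \<Longrightarrow> (\<And>x. x \<in> S \<Longrightarrow> f x = g x) \<Longrightarrow> Cinf_on S f \<Longrightarrow> Cinf_on S g"
  unfolding Cinf_on_def using Ck_on_cong by blast

lemma fderiv_cong:
  assumes "open S" "\<And>x. x \<in> S \<Longrightarrow> f x = g x" "Cinf_on S f" "x \<in> S"
  shows "fderiv g x v = fderiv f x v"
  using assms has_derivative_transform_within_open[OF Cinf_onD[OF assms(3,4)] assms(1,4)] fderiv_eq
  by metis

lemma Cinf_on_mult: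
  fixes f g :: "'a::real_normed_vector \<Rightarrow> real"
  shows "open S \<Longrightarrow> Cinf_on S f \<Longrightarrow> Cinf_on S g \<Longrightarrow> Cinf_on S (\<lambda>x. f x * g x)"
  unfolding Cinf_on_def using Ck_on_bilinear[OF bounded_bilinear_mult] by blast

lemma Cinf_on_inner:
  fixes f g :: "'a::real_normed_vector \<Rightarrow> 'b::real_inner"
  shows "open S \<Longrightarrow> Cinf_on S f \<Longrightarrow> Cinf_on S g \<Longrightarrow> Cinf_on S (\<lambda>x. f x \<bullet> g x)"
  unfolding Cinf_on_def using Ck_on_bilinear[OF bounded_bilinear_inner] by blast

lemma Cinf_on_uminus:
  "open S \<Longrightarrow> Cinf_on S f \<Longrightarrow> Cinf_on S (\<lambda>x. - f x)"
  unfolding Cinf_on_def using Ck_on_linear[OF bounded_linear_minus[OF bounded_linear_ident]] by blast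

lemma Cinf_on_sum:
  "open S \<Longrightarrow> (\<And>i. i \<in> I \<Longrightarrow> Cinf_on S (f i)) \<Longrightarrow> Cinf_on S (\<lambda>x. \<Sum>i\<in>I. f i x)"
  by (auto simp: Cinf_on_def intro: Ck_on_sum)

lemma Cinf_on_bounded_linear: "bounded_linear L \<Longrightarrow> open S \<Longrightarrow> Cinf_on S L"
  unfolding Cinf_on_def using Ck_on_bounded_linear by blast

lemma Cinf_on_const: "open S \<Longrightarrow> Cinf_on S (\<lambda>_. c)"
  unfolding Cinf_on_def using Ck_on_const by blast

lemma Cinf_on_add: "open S \<Longrightarrow> Cinf_on S f \<Longrightarrow> Cinf_on S g \<Longrightarrow> Cinf_on S (\<lambda>x. f x + g x)"
  unfolding Cinf_on_def using Ck_on_add by blast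

lemma Cinf_on_scaleR: "open S \<Longrightarrow> Cinf_on S f \<Longrightarrow> Cinf_on S g \<Longrightarrow> Cinf_on S (\<lambda>x. f x *\<^sub>R g x)"
  unfolding Cinf_on_def using Ck_on_bilinear[OF bounded_bilinear_scaleR] by blast

lemma Cinf_on_inverse:
  fixes f :: "'a::real_normed_vector \<Rightarrow> real"
  shows "open S \<Longrightarrow> (\<And>x. x \<in> S \<Longrightarrow> f x \<noteq> 0) \<Longrightarrow> Cinf_on S f \<Longrightarrow> Cinf_on S (\<lambda>x. inverse (f x))"
  by (simp add: Cinf_on_def Ck_on_inverse)

lemma Cinf_on_exp:
  fixes f :: "'a::real_normed_vector \<Rightarrow> real"
  shows "open S \<Longrightarrow> Cinf_on S f \<Longrightarrow> Cinf_on S (\<lambda>x. exp (f x))"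
  by (simp add: Cinf_on_def Ck_on_exp)

lemma Cinf_on_linear:
  "bounded_linear L \<Longrightarrow> open S \<Longrightarrow> Cinf_on S f \<Longrightarrow> Cinf_on S (\<lambda>x. L (f x))"
  unfolding Cinf_on_def using Ck_on_linear by blast

lemma Cinf_on_vec_lambda:
  fixes f :: "'a::real_normed_vector \<Rightarrow> 'i::finite \<Rightarrow> real"
  assumes "open S" "\<And>i. Cinf_on S (\<lambda>x. f x i)"
  shows "Cinf_on S (\<lambda>x. \<chi> i. f x i)"
  using Ck_on_vec_lambda[OF assms(1), of _ f] assms(2) by (simp add: Cinf_on_def)

lemma Cinf_on_compose:
  fixes g :: "'a::real_normed_vector \<Rightarrow> 'b::euclidean_space"
  assumes "open S" "Cinf_on T f" "Cinf_on S g" "g ` S \<subseteq> T"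
  shows "Cinf_on S (\<lambda>x. f (g x))"
  using Ck_on_compose[OF assms(1) _ _ assms(4), of _ f] assms(2,3) by (simp add: Cinf_on_def)

lemma fderiv_compose:
  assumes "Cinf_on T f" "Cinf_on S g" "x \<in> S" "g x \<in> T"
  shows "fderiv (\<lambda>x. f (g x)) x v = fderiv f (g x) (fderiv g x v)"
proof -
  have "((\<lambda>x. f (g x)) has_derivative (\<lambda>v. fderiv f (g x) (fderiv g x v))) (at x)"
    by (rule has_derivative_compose[where f=g and g=f, OF Cinf_onD[OF assms(2,3)] Cinf_onD[OF assms(1,4)]])
  from fderiv_eq[OF this] show ?thesis by simp
qed

lemma Cinf_on_imp_smooth_on: "open W \<Longrightarrow> S \<subseteq> W \<Longrightarrow> Cinf_on W f \<Longrightarrow> smooth_on S f"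
  unfolding smooth_on_def Cinf_on_def by blast

lemma smooth_on_open_iff:
  assumes "open S"
  shows "smooth_on S f \<longleftrightarrow> Cinf_on S f"
proof
  assume "smooth_on S f"
  then obtain W F where W: "S \<subseteq> W" "\<And>k. Ck_on k W F" "\<And>x. x \<in> S \<Longrightarrow> F x = f x"
    unfolding smooth_on_def by blast
  show "Cinf_on S f"
    unfolding Cinf_on_def by (intro allI Ck_on_cong[OF assms W(3) Ck_on_subset[OF W(2,1)]])
qed (use assms Cinf_on_imp_smooth_on in blast)

lemma smooth_on_compose_Cinf_on:
  fixes g :: "'a::real_normed_vector \<Rightarrow> 'b::euclidean_space"
  assumes "smooth_on T f" "open S" "Cinf_on S g" "g ` S \<subseteq> T"
  shows "Cinf_on S (\<lambda>x. f (g x))"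
proof -
  obtain W F where W: "T \<subseteq> W" "Cinf_on W F" "\<And>x. x \<in> T \<Longrightarrow> F x = f x"
    using assms(1) unfolding smooth_on_def Cinf_on_def by blast
  have "Cinf_on S (\<lambda>x. F (g x))"
    by (rule Cinf_on_compose[OF assms(2) W(2) assms(3)]) (use assms(4) W(1) in blast)
  then show ?thesis
    by (rule Cinf_on_cong[OF assms(2), rotated]) (use W(3) assms(4) in blast)
qed

lemma smooth_on_const: "smooth_on S (\<lambda>_. c)"
  by (rule Cinf_on_imp_smooth_on[OF open_UNIV subset_UNIV Cinf_on_const[OF open_UNIV]])

section \<open>Smoothness of inverse maps\<close>

lemma Ck_on_det:
  fixes A :: "'a::real_normed_vector \<Rightarrow> real^'m^'m"
  assumes "open S" "\<And>i j. Ck_on k S (\<lambda>x. A x $ i $ j)"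
  shows "Ck_on k S (\<lambda>x. det (A x))"
  unfolding det_def
  by (intro Ck_on_sum Ck_on_prod Ck_on_bilinear[OF bounded_bilinear_mult] Ck_on_const assms)

lemma matrix_inv_inverse:
  fixes A :: "real^'m^'m"
  assumes "det A \<noteq> 0"
  shows "A ** matrix_inv A = mat 1" "matrix_inv A ** A = mat 1"
proof -
  have "\<exists>B. A ** B = mat 1 \<and> B ** A = mat 1"
    using assms invertible_det_nz unfolding invertible_def by blast
  from someI_ex[OF this] show "A ** matrix_inv A = mat 1" "matrix_inv A ** A = mat 1"
    unfolding matrix_inv_def by blast+
qed

text \<open>By Cramer's rule the entries of the inverse are quotients of determinants.\<close>

lemma Ck_on_matrix_inv:
  fixes A :: "'a::real_normed_vector \<Rightarrow> real^'m^'m"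
  assumes "open S" "\<And>x. x \<in> S \<Longrightarrow> det (A x) \<noteq> 0" "\<And>i j. Ck_on k S (\<lambda>x. A x $ i $ j)"
  shows "Ck_on k S (\<lambda>x. matrix_inv (A x) $ i $ j)"
proof -
  define C where "C x = (\<chi> a b. if b = i then axis j 1 $ a else A x $ a $ b)" for x
  have "matrix_inv (A x) $ i $ j = det (C x) * inverse (det (A x))" if "x \<in> S" for x
  proof -
    have "A x *v (matrix_inv (A x) *v axis j 1) = axis j 1"
      by (simp add: matrix_vector_mul_assoc matrix_inv_inverse assms(2)[OF that])
    then have "(matrix_inv (A x) *v axis j 1) $ i = det (C x) / det (A x)"
      unfolding cramer[OF assms(2)[OF that]] C_def by (simp add: vec_eq_iff)
    then show ?thesis
      by (simp add: matrix_vector_mult_basis column_def divide_inverse)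
  qed
  moreover have "Ck_on k S (\<lambda>x. C x $ a $ b)" for a b
    by (cases "b = i") (simp_all add: C_def assms Ck_on_const)
  then have "Ck_on k S (\<lambda>x. det (C x) * inverse (det (A x)))"
    by (intro Ck_on_bilinear[OF bounded_bilinear_mult] Ck_on_inverse Ck_on_det assms)
  ultimately show ?thesis
    by (intro Ck_on_cong[OF assms(1) _ \<open>Ck_on k S (\<lambda>x. det (C x) * inverse (det (A x)))\<close>]) simp
qed

text \<open>Invariance of domain gives openness of the image and continuity of the inverse \<open>g\<close>. Then \<open>g\<close> is
differentiable with derivative \<open>Df(g y)\<^sup>-\<^sup>1\<close>, and this formula raises the differentiability class of
\<open>g\<close> by one at each step.\<close>

lemma Cinf_on_inv_into:
  fixes f :: "real^'m \<Rightarrow> real^'m"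
  assumes "open S" "Cinf_on S f" "inj_on f S"
    and nonsing: "\<And>x v. x \<in> S \<Longrightarrow> fderiv f x v = 0 \<Longrightarrow> v = 0"
  shows "open (f ` S)" "Cinf_on (f ` S) (inv_into S f)"
proof -
  let ?g = "inv_into S f"
  have Ck: "Ck_on k S f" for k using assms(2) by (simp add: Cinf_on_def)
  note D = Ck_on_SucD[OF Ck]
  have cont: "continuous_on S f" using Ck[of 0] by simp
  show op: "open (f ` S)" using invariance_of_domain[OF cont assms(1,3)] .
  define A where "A x = matrix (fderiv f x)" for x
  have lin: "linear (fderiv f x)" if "x \<in> S" for x
    using D(1)[OF that] has_derivative_linear by blast
  have A: "A x *v v = fderiv f x v" if "x \<in> S" for x v
    unfolding A_def using matrix_vector_mul(2)[OF lin[OF that]] by metis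
  have det: "det (A x) \<noteq> 0" if "x \<in> S" for x
    using det_nz_iff_inj[OF lin[OF that]] linear_injective_0[OF lin[OF that]] nonsing[OF that]
    by (auto simp: A_def)
  have contg: "continuous_on (f ` S) ?g"
    using invariance_of_domain_homeomorphism[OF assms(1) cont _ assms(3)]
    by (metis assms(1,3) cont continuous_on_inverse_open inv_into_f_f order_refl)
  have dg: "(?g has_derivative (\<lambda>v. matrix_inv (A (?g y)) *v v)) (at y)" if y: "y \<in> f ` S" for y
  proof -
    obtain x where x: "x \<in> S" "y = f x" using y by blast
    have gy: "?g y = x" using x assms(3) by simp
    have "(?g has_derivative (\<lambda>v. matrix_inv (A x) *v v)) (at (f x))"
    proof (rule has_derivative_inverse_dieudonne[OF assms(1) op cont contg _ x(1) D(1)[OF x(1)]])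
      show "bounded_linear ((*v) (matrix_inv (A x)))"
        by (rule matrix_vector_mul_bounded_linear)
      show "(*v) (matrix_inv (A x)) \<circ> fderiv f x = id"
        by (auto simp: A[OF x(1), symmetric] matrix_vector_mul_assoc matrix_inv_inverse det[OF x(1)])
    qed (use assms(3) in auto)
    then show ?thesis using x gy by simp
  qed
  have gS: "?g ` (f ` S) \<subseteq> S" by (auto simp: assms(3))
  have "Ck_on k (f ` S) ?g" for k
  proof (induction k)
    case 0
    then show ?case using contg by simp
  next
    case (Suc k)
    have ent: "Ck_on k (f ` S) (\<lambda>y. A (?g y) $ i $ j)" for i j
    proof -
      have "Ck_on k (f ` S) (\<lambda>y. fderiv f (?g y) (axis j 1))"
        using Ck_on_compose[OF op D(2) Suc.IH gS] .
      then have "Ck_on k (f ` S) (\<lambda>y. fderiv f (?g y) (axis j 1) $ i)"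
        by (rule Ck_on_linear[OF bounded_linear_vec_nth op])
      then show ?thesis by (simp add: A_def matrix_def)
    qed
    have "Ck_on k (f ` S) (\<lambda>y. matrix_inv (A (?g y)) $ i $ j)" for i j
      by (rule Ck_on_matrix_inv[OF op _ ent]) (use det gS in blast)
    then show ?case
      by (intro Ck_on_SucI[OF op dg])
        (auto simp: matrix_vector_mult_def
          intro!: Ck_on_vec_lambda Ck_on_sum op Ck_on_linear[OF bounded_linear_mult_left])
  qed
  then show "Cinf_on (f ` S) ?g" by (simp add: Cinf_on_def)
qed

section \<open>Derivatives along lines and symmetry of second derivatives\<close>

lemma has_real_derivative_along_line:
  fixes f :: "'a::real_normed_vector \<Rightarrow> real"
  assumes "(f has_derivative f') (at (p + t *\<^sub>R v))"
  shows "((\<lambda>t. f (p + t *\<^sub>R v)) has_real_derivative f' v) (at t)"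
proof -
  have "((\<lambda>t. f (p + t *\<^sub>R v)) has_derivative (\<lambda>s. f' (s *\<^sub>R v))) (at t)"
    by (rule has_derivative_compose[where f="\<lambda>t. p + t *\<^sub>R v" and g=f])
      (auto intro!: derivative_eq_intros simp: assms)
  then show ?thesis
    using has_derivative_linear[OF assms] by (simp add: linear_cmul has_field_derivative_def mult_commute_abs)
qed

lemma dir_deriv_eq:
  fixes f :: "'a::real_normed_vector \<Rightarrow> real"
  assumes "(f has_derivative f') (at p)"
  shows "dir_deriv f p v = f' v"
  unfolding dir_deriv_def
  by (rule DERIV_imp_deriv, rule has_real_derivative_along_line) (simp add: assms)

text \<open>Stated for open sets, where a line through \<open>x\<close> in any direction stays in the set for a short time.\<close>

lemma dir_deriv_cong:
  fixes x :: "'a::real_normed_vector"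
  assumes "open V" "x \<in> V" "\<And>y. y \<in> V \<Longrightarrow> f y = g y"
  shows "dir_deriv f x v = dir_deriv g x v"
proof -
  have "((\<lambda>t. x + t *\<^sub>R v) \<longlongrightarrow> x + 0 *\<^sub>R v) (nhds (0::real))"
    by (intro tendsto_intros filterlim_ident)
  then have "\<forall>\<^sub>F t in nhds (0::real). x + t *\<^sub>R v \<in> V"
    using topological_tendstoD[OF _ assms(1)] assms(2) by force
  then have "\<forall>\<^sub>F t in nhds (0::real). f (x + t *\<^sub>R v) = g (x + t *\<^sub>R v)"
    by eventually_elim (simp add: assms(3))
  then show ?thesis unfolding dir_deriv_def by (rule deriv_cong_ev) simp
qed

lemma partial_deriv_eq:
  "(f has_derivative f') (at x) \<Longrightarrow> partial_deriv i f x = f' (axis i 1)"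
  unfolding partial_deriv_def by (rule dir_deriv_eq)

lemma partial_deriv_cong:
  assumes "open V" "x \<in> V" "\<And>y. y \<in> V \<Longrightarrow> f y = g y"
  shows "partial_deriv i f x = partial_deriv i g x"
  unfolding partial_deriv_def by (rule dir_deriv_cong[OF assms])

text \<open>Applying the mean value theorem first in direction \<open>u\<close> and then in direction \<open>v\<close>, the second
difference is \<open>h\<^sup>2\<close> times the iterated derivative at a point close to \<open>x\<close>. Since the second
difference is symmetric in \<open>u\<close> and \<open>v\<close>, so is the limit.\<close>

lemma second_difference_quotient:
  fixes f :: "'a::real_normed_vector \<Rightarrow> real"
  assumes "open S" "Ck_on 2 S f" "x \<in> S"
  shows "((\<lambda>h. (f (x + h *\<^sub>R u + h *\<^sub>R v) - f (x + h *\<^sub>R u) - f (x + h *\<^sub>R v) + f x) / (h * h))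
     \<longlongrightarrow> fderiv (\<lambda>y. fderiv f y u) x v) (at_right 0)"
proof -
  let ?d = "\<lambda>h. f (x + h *\<^sub>R u + h *\<^sub>R v) - f (x + h *\<^sub>R u) - f (x + h *\<^sub>R v) + f x"
  let ?F = "\<lambda>y. fderiv (\<lambda>y. fderiv f y u) y v"
  have C: "Ck_on (Suc (Suc 0)) S f" using assms(2) by (simp only: numeral_2_eq_2)
  note D1 = Ck_on_SucD[OF C]
  note D2 = Ck_on_SucD[OF D1(2)[of u]]
  have contF: "continuous_on S ?F" using D2(2)[of v] by simp
  show ?thesis
  proof (rule tendstoI)
    fix e :: real assume e: "e > 0"
    have "isCont ?F x" using contF assms(1,3) continuous_on_eq_continuous_at by blast
    then obtain d where d: "d > 0" "\<And>y. dist y x < d \<Longrightarrow> dist (?F y) (?F x) < e"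
      using e unfolding continuous_at_eps_delta by blast
    obtain d' where d': "d' > 0" "ball x d' \<subseteq> S" using assms(1,3) open_contains_ball by blast
    define \<delta> where "\<delta> = min d d' / (norm u + norm v + 1)"
    have pos: "\<delta> > 0" using d(1) d'(1) by (auto simp: \<delta>_def intro!: divide_pos_pos add_nonneg_pos)
    \<comment> \<open>the parallelogram spanned by \<open>s u\<close> and \<open>t v\<close> stays in the ball by the choice of \<open>\<delta>\<close>\<close>
    have near: "dist (x + s *\<^sub>R u + t *\<^sub>R v) x < min d d'" if "0 \<le> s" "s < \<delta>" "0 \<le> t" "t < \<delta>" for s t
    proof -
      have "dist (x + s *\<^sub>R u + t *\<^sub>R v) x \<le> s * norm u + t * norm v"
        using norm_triangle_ineq[of "s *\<^sub>R u" "t *\<^sub>R v"] that by (simp add: dist_norm add.assoc)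
      also have "\<dots> \<le> \<delta> * norm u + \<delta> * norm v"
        using that by (intro add_mono mult_right_mono) auto
      also have "\<dots> < \<delta> * (norm u + norm v + 1)" using pos by (simp add: algebra_simps)
      also have "\<dots> = min d d'"
        unfolding \<delta>_def by (simp, metis add_nonneg_eq_0_iff add_nonneg_nonneg norm_ge_zero zero_le_one zero_neq_one)
      finally show ?thesis .
    qed
    have inS: "x + s *\<^sub>R u + t *\<^sub>R v \<in> S" if "0 \<le> s" "s < \<delta>" "0 \<le> t" "t < \<delta>" for s t
      using near[OF that] d'(2) by (auto simp: dist_commute)
    have main: "dist (?d h / (h * h)) (?F x) < e" if h: "0 < h" "h < \<delta>" for h
    proof -
      let ?k = "\<lambda>s. f (x + s *\<^sub>R u + h *\<^sub>R v) - f (x + s *\<^sub>R u)"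
      have dk: "(?k has_real_derivative fderiv f (x + s *\<^sub>R u + h *\<^sub>R v) u - fderiv f (x + s *\<^sub>R u) u) (at s)"
        if "0 \<le> s" "s \<le> h" for s
      proof -
        have *: "((\<lambda>s. f (x + s *\<^sub>R u + c)) has_real_derivative fderiv f (x + s *\<^sub>R u + c) u) (at s)"
          if "x + s *\<^sub>R u + c \<in> S" for c
          using has_real_derivative_along_line[of f _ "x + c" s u] D1(1)[OF that] by (simp add: add_ac)
        have "x + s *\<^sub>R u + h *\<^sub>R v \<in> S" "x + s *\<^sub>R u + 0 \<in> S"
          using inS[of s h] inS[of s 0] that h pos by auto
        from DERIV_diff[OF *[OF this(1)] *[OF this(2)]] show ?thesis by simp
      qed
      obtain s where s: "0 < s" "s < h" "?k h - ?k 0 =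
          h * (fderiv f (x + s *\<^sub>R u + h *\<^sub>R v) u - fderiv f (x + s *\<^sub>R u) u)"
        using MVT2[OF h(1) dk] by auto
      let ?l = "\<lambda>t. fderiv f (x + s *\<^sub>R u + t *\<^sub>R v) u"
      have dl: "(?l has_real_derivative ?F (x + s *\<^sub>R u + t *\<^sub>R v)) (at t)" if "0 \<le> t" "t \<le> h" for t
      proof -
        have inn: "x + s *\<^sub>R u + t *\<^sub>R v \<in> S" using inS[of s t] that h s by auto
        show ?thesis
          by (rule has_real_derivative_along_line[where f="\<lambda>y. fderiv f y u", OF D2(1)[OF inn]])
      qed
      obtain t where t: "0 < t" "t < h" "?l h - ?l 0 = h * ?F (x + s *\<^sub>R u + t *\<^sub>R v)"
        using MVT2[OF h(1) dl] by auto
      have "?d h = h * (h * ?F (x + s *\<^sub>R u + t *\<^sub>R v))" using s(3) t(3) by simp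
      then have "?d h / (h * h) = ?F (x + s *\<^sub>R u + t *\<^sub>R v)" using h by simp
      then show ?thesis using d(2) near[of s t] s t h by auto
    qed
    show "\<forall>\<^sub>F h in at_right 0. dist (?d h / (h * h)) (?F x) < e"
      unfolding eventually_at_right_field using main pos by blast
  qed
qed

lemma fderiv_commute_real:
  fixes f :: "'a::real_normed_vector \<Rightarrow> real"
  assumes "open S" "Ck_on 2 S f" "x \<in> S"
  shows "fderiv (\<lambda>y. fderiv f y u) x v = fderiv (\<lambda>y. fderiv f y v) x u"
proof (rule tendsto_unique[OF trivial_limit_at_right_real second_difference_quotient[OF assms, of u v]])
  show "((\<lambda>h. (f (x + h *\<^sub>R u + h *\<^sub>R v) - f (x + h *\<^sub>R u) - f (x + h *\<^sub>R v) + f x) / (h * h))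
      \<longlongrightarrow> fderiv (\<lambda>y. fderiv f y v) x u) (at_right 0)"
    using second_difference_quotient[OF assms, of v u] by (simp add: algebra_simps)
qed

lemma fderiv_commute:
  fixes f :: "'a::real_normed_vector \<Rightarrow> 'b::euclidean_space"
  assumes S: "open S" and f: "Cinf_on S f" and x: "x \<in> S"
  shows "fderiv (\<lambda>y. fderiv f y u) x v = fderiv (\<lambda>y. fderiv f y v) x u"
proof (rule euclidean_eqI)
  fix b :: 'b
  let ?g = "\<lambda>y. f y \<bullet> b"
  have inner: "fderiv (\<lambda>y. h y \<bullet> b) y t = fderiv h y t \<bullet> b" if "Cinf_on S h" "y \<in> S" for h y t
    using fderiv_eq[OF has_derivative_inner_left[OF Cinf_onD[OF that]]] by metis
  have C: "Cinf_on S (\<lambda>y. h y \<bullet> b)" if "Cinf_on S h" for h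
    using that Ck_on_linear[OF bounded_linear_inner_left S] unfolding Cinf_on_def by blast
  have second: "fderiv (\<lambda>y. fderiv ?g y s) x t = fderiv (\<lambda>y. fderiv f y s) x t \<bullet> b" for s t
    using fderiv_cong[OF S _ C[OF Cinf_on_fderiv[OF f]] x, of s "\<lambda>y. fderiv ?g y s"]
      inner[OF f] inner[OF Cinf_on_fderiv[OF f] x] by simp
  show "fderiv (\<lambda>y. fderiv f y u) x v \<bullet> b = fderiv (\<lambda>y. fderiv f y v) x u \<bullet> b"
    using fderiv_commute_real[OF S _ x, of ?g u v] C[OF f] second unfolding Cinf_on_def by metis
qed

section \<open>Conormal pairs: Gauss equation, curvature and geodesics\<close>

abbreviation pd :: "(real^'m \<Rightarrow> 'b::real_normed_vector) \<Rightarrow> 'm \<Rightarrow> real^'m \<Rightarrow> 'b"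
  where "pd f i x \<equiv> fderiv f x (axis i 1)"

lemma fderiv_eq_sum_pd:
  fixes f :: "real^'m \<Rightarrow> 'b::real_normed_vector"
  assumes "(f has_derivative fderiv f x) (at x)"
  shows "fderiv f x v = (\<Sum>i\<in>UNIV. v $ i *\<^sub>R pd f i x)"
proof -
  have "v = (\<Sum>i\<in>UNIV. v $ i *\<^sub>R axis i 1)"
    using basis_expansion[of v] by (simp add: scalar_mult_eq_scaleR)
  then have "fderiv f x v = fderiv f x (\<Sum>i\<in>UNIV. v $ i *\<^sub>R axis i 1)" by simp
  then show ?thesis
    using has_derivative_linear[OF assms] by (simp only: linear_sum linear_cmul)
qed

text \<open>The Christoffel symbols \<open>\<Sum>\<^sub>l \<Gamma>\<^sub>i\<^sub>j\<^sub>l g\<^sup>l\<^sup>k\<close> of the divergence \<open>ln (w(x') \<bullet> r(x))\<close>. Exchanging the two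
arguments yields those of the dual connection.\<close>

definition christoffel_pair :: "(real^'m \<Rightarrow> real^'n) \<Rightarrow> (real^'m \<Rightarrow> real^'n) \<Rightarrow> 'm::finite christoffel"
  where "christoffel_pair r w x i j k =
    (\<Sum>l\<in>UNIV. - (pd w l x \<bullet> pd (pd r j) i x) *
      matrix_inv (\<chi> a b. - (pd w b x \<bullet> pd r a x)) $ l $ k)"

text \<open>A hypersurface \<open>r\<close> that is transversal to its position vector, together with its conormal map \<open>w\<close>
normalised by \<open>w \<bullet> r = 1\<close>. The second fundamental form of \<open>r\<close> relative to the transversal field \<open>r\<close>
is \<open>- dw \<bullet> dr\<close>; the last assumption makes it positive definite.\<close>

locale conormal_pair =
  fixes V :: "(real^'m) set" and r w :: "real^'m \<Rightarrow> real^'n"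
  assumes dim: "CARD('n) = CARD('m) + 1"
    and op: "open V"
    and r: "Cinf_on V r" and w: "Cinf_on V w"
    and pair: "\<And>x. x \<in> V \<Longrightarrow> w x \<bullet> r x = 1"
    and conormal: "\<And>x v. x \<in> V \<Longrightarrow> w x \<bullet> fderiv r x v = 0"
    and neg: "\<And>x v. x \<in> V \<Longrightarrow> v \<noteq> 0 \<Longrightarrow> fderiv w x v \<bullet> fderiv r x v < 0"
begin

definition G :: "real^'m \<Rightarrow> 'm \<Rightarrow> 'm \<Rightarrow> real" where "G x i j = - (pd w j x \<bullet> pd r i x)"

abbreviation "\<Gamma> \<equiv> christoffel_pair r w"

lemma inner_derivative:
  assumes "x \<in> V" "Cinf_on V f" "Cinf_on V g"
  shows "fderiv (\<lambda>y. f y \<bullet> g y :: real) x v = f x \<bullet> fderiv g x v + fderiv f x v \<bullet> (g x :: real^'n)"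
  using fderiv_eq[OF has_derivative_inner[OF Cinf_onD[OF assms(2,1)] Cinf_onD[OF assms(3,1)]]]
  by simp

lemma const_derivative:
  assumes "x \<in> V" "\<And>y. y \<in> V \<Longrightarrow> f y = c" "Cinf_on V f"
  shows "fderiv f x v = 0"
proof -
  have "((\<lambda>_. c) has_derivative (\<lambda>_. 0)) (at x)" by simp
  then have "(f has_derivative (\<lambda>_. 0)) (at x)"
    by (rule has_derivative_transform_within_open[OF _ op assms(1)]) (simp add: assms(2))
  then show ?thesis using fderiv_eq by metis
qed

text \<open>From \<open>w \<bullet> r = 1\<close> and \<open>w \<bullet> dr = 0\<close> by the product rule.\<close>

lemma conormal': "x \<in> V \<Longrightarrow> fderiv w x v \<bullet> r x = 0"
  using const_derivative[of x "\<lambda>y. w y \<bullet> r y" 1 v] inner_derivative[of x w r v] pair conormal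
    Cinf_on_inner[OF op w r] r w by simp

lemma conormal_second:
  assumes "x \<in> V"
  shows "w x \<bullet> fderiv (\<lambda>y. fderiv r y u) x v = - (fderiv w x v \<bullet> fderiv r x u)"
  using const_derivative[of x "\<lambda>y. w y \<bullet> fderiv r y u" 0 v] conormal assms
    inner_derivative[OF assms w Cinf_on_fderiv[OF r, of u], of v] Cinf_on_inner[OF op w Cinf_on_fderiv[OF r]]
  by simp

text \<open>By the preceding lemma both sides equal \<open>- w \<bullet> D\<^sup>2 r(u, v)\<close>.\<close>

lemma metric_commute:
  assumes "x \<in> V"
  shows "fderiv w x v \<bullet> fderiv r x u = fderiv w x u \<bullet> fderiv r x v"
  using conormal_second[OF assms, of u v] conormal_second[OF assms, of v u]
    fderiv_commute[OF op r assms, of u v] by simp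

text \<open>The assumptions are symmetric in the two maps, so all results on the primal connection carry over
to the dual one.\<close>

lemma swap: "conormal_pair V w r"
  using dim op r w pair neg conormal' by unfold_locales (auto simp: inner_commute)

lemma G_commute: "x \<in> V \<Longrightarrow> G x i j = G x j i"
  unfolding G_def using metric_commute by simp

lemma metric_eq_sum:
  assumes "x \<in> V"
  shows "- (fderiv w x v \<bullet> fderiv r x u) = (\<Sum>i\<in>UNIV. \<Sum>j\<in>UNIV. G x i j * u $ i * v $ j)"
  unfolding fderiv_eq_sum_pd[OF Cinf_onD[OF w assms], of v] fderiv_eq_sum_pd[OF Cinf_onD[OF r assms], of u]
  by (simp add: inner_sum_left inner_sum_right G_def sum_negf[symmetric] sum_distrib_left mult_ac)

lemma det_G:
  assumes "x \<in> V"
  shows "det (\<chi> i j. G x i j) \<noteq> 0"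
proof -
  let ?A = "\<chi> i j. G x i j"
  have "v = 0" if "?A *v v = 0" for v
  proof (rule ccontr)
    assume "v \<noteq> 0"
    have "v \<bullet> (?A *v v) = (\<Sum>i\<in>UNIV. \<Sum>j\<in>UNIV. G x i j * v $ i * v $ j)"
      by (simp add: inner_vec_def matrix_vector_mult_def sum_distrib_left mult_ac)
    then have "fderiv w x v \<bullet> fderiv r x v = 0"
      using metric_eq_sum[OF assms, of v v] that by simp
    then show False using neg[OF assms \<open>v \<noteq> 0\<close>] by simp
  qed
  then have "inj ((*v) ?A)" by (simp add: linear_injective_0)
  then have "det (matrix ((*v) ?A)) \<noteq> 0" by (subst det_nz_iff_inj) auto
  then show ?thesis by simp
qed

lemma inverse_metric_mult:
  assumes "x \<in> V"
  shows "(\<Sum>k\<in>UNIV. matrix_inv (\<chi> a b. G x a b) $ l $ k * G x k j) = (if l = j then 1 else 0)"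
proof -
  have "(matrix_inv (\<chi> a b. G x a b) ** (\<chi> a b. G x a b)) $ l $ j = mat 1 $ l $ j"
    by (simp add: matrix_inv_inverse[OF det_G[OF assms]])
  then show ?thesis by (simp add: matrix_matrix_mult_def mat_def)
qed

lemma \<Gamma>_eq:
  "\<Gamma> x i j k = (\<Sum>l\<in>UNIV. - (pd w l x \<bullet> pd (pd r j) i x) * matrix_inv (\<chi> a b. G x a b) $ l $ k)"
  by (simp add: christoffel_pair_def G_def)

text \<open>The map \<open>(v, s) \<mapsto> dw v + s w\<close> from \<open>\<real>\<^sup>m \<times> \<real>\<close> to \<open>\<real>\<^sup>n\<close> is injective: pairing with \<open>r\<close> isolates \<open>s\<close>,
and \<open>dw\<close> is injective by definiteness. As \<open>n = m + 1\<close> it is onto, and \<open>z\<close> is orthogonal to its range.\<close>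

lemma eq_zero_if_orthogonal:
  assumes x: "x \<in> V" and z: "z \<bullet> w x = 0" "\<And>l. z \<bullet> pd w l x = 0"
  shows "z = 0"
proof -
  have lin: "linear (fderiv w x)" using Cinf_onD[OF w x] has_derivative_linear by blast
  define h where "h p = fderiv w x (fst p) + snd p *\<^sub>R w x" for p :: "(real^'m) \<times> real"
  have linh: "linear h"
    by (rule linearI) (simp_all add: h_def linear_add[OF lin] linear_cmul[OF lin] algebra_simps)
  have "p = 0" if "h p = 0" for p
  proof -
    have eq: "fderiv w x (fst p) + snd p *\<^sub>R w x = 0" using that by (simp add: h_def)
    have "snd p = (fderiv w x (fst p) + snd p *\<^sub>R w x) \<bullet> r x"
      using conormal'[OF x] pair[OF x] by (simp add: inner_add_left)
    then have s: "snd p = 0" using eq by simp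
    then have "fst p = 0" using eq neg[OF x, of "fst p"] by force
    then show ?thesis using s by (simp add: prod_eq_iff)
  qed
  then have inj: "inj h" by (simp add: linear_injective_0[OF linh])
  have "dim (range h) = DIM((real^'m) \<times> real)"
    using dim_image_eq[OF linh] inj by simp
  then have "dim (range h) = DIM(real^'n)" using dim by simp
  then have "range h = UNIV"
    using dim_eq_full[of "range h"] linear_subspace_image[OF linh subspace_UNIV] by (metis span_eq_iff)
  then obtain p where "z = h p" by blast
  moreover have "z \<bullet> h p = 0"
    unfolding h_def fderiv_eq_sum_pd[OF Cinf_onD[OF w x], of "fst p"]
    using z by (simp add: inner_add_right inner_sum_right)
  ultimately show ?thesis by simp
qed

text \<open>The Gauss equation. It suffices to compare the pairings of both sides with \<open>w\<close> and with the
\<open>\<partial>\<^sub>l w\<close>. The former yields the coefficient of \<open>r\<close>; the latter is the definition of the Christoffel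
symbols, solved for the lower ones.\<close>

lemma gauss:
  assumes x: "x \<in> V"
  shows "pd (pd r j) i x = (\<Sum>k\<in>UNIV. \<Gamma> x i j k *\<^sub>R pd r k x) + G x i j *\<^sub>R r x"
proof -
  define z where "z = pd (pd r j) i x - ((\<Sum>k\<in>UNIV. \<Gamma> x i j k *\<^sub>R pd r k x) + G x i j *\<^sub>R r x)"
  have "z = 0"
  proof (rule eq_zero_if_orthogonal[OF x])
    have "w x \<bullet> pd (pd r j) i x = G x i j"
      using conormal_second[OF x] G_commute[OF x, of i j] by (simp add: G_def)
    then show "z \<bullet> w x = 0"
      using conormal[OF x] pair[OF x]
      by (simp add: z_def inner_diff_left inner_add_left inner_sum_left inner_commute[of _ "w x"]
          inner_diff_right inner_add_right inner_sum_right)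
    fix l
    let ?a = "\<lambda>m. - (pd w m x \<bullet> pd (pd r j) i x)"
    let ?I = "matrix_inv (\<chi> a b. G x a b)"
    have "(\<Sum>k\<in>UNIV. \<Gamma> x i j k *\<^sub>R pd r k x) \<bullet> pd w l x = - (\<Sum>k\<in>UNIV. \<Gamma> x i j k * G x k l)"
      unfolding inner_sum_left G_def by (simp add: sum_negf inner_commute[of "pd w l x"])
    also have "(\<Sum>k\<in>UNIV. \<Gamma> x i j k * G x k l) = (\<Sum>k\<in>UNIV. \<Sum>m\<in>UNIV. ?a m * (?I $ m $ k * G x k l))"
      unfolding \<Gamma>_eq by (simp only: sum_distrib_right mult.assoc)
    also have "\<dots> = (\<Sum>m\<in>UNIV. ?a m * (\<Sum>k\<in>UNIV. ?I $ m $ k * G x k l))"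
      by (subst sum.swap) (simp only: sum_distrib_left)
    also have "\<dots> = ?a l"
      by (simp add: inverse_metric_mult[OF x] if_distrib sum.delta cong: if_cong)
    finally show "z \<bullet> pd w l x = 0"
      using conormal'[OF x]
      unfolding z_def inner_diff_left inner_add_left inner_scaleR_left by (simp add: inner_commute)
  qed
  then show ?thesis by (simp add: z_def)
qed

lemma G_smooth: "Cinf_on V (\<lambda>x. G x i j)"
  unfolding G_def by (intro Cinf_on_uminus Cinf_on_inner op Cinf_on_fderiv r w)

lemma \<Gamma>_smooth: "Cinf_on V (\<lambda>x. \<Gamma> x i j k)"
proof -
  have "Cinf_on V (\<lambda>x. matrix_inv (\<chi> a b. G x a b) $ l $ k)" for l
    unfolding Cinf_on_def
    by (intro allI Ck_on_matrix_inv op det_G)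
      (use G_smooth in \<open>auto simp: Cinf_on_def\<close>)
  then show ?thesis
    unfolding \<Gamma>_eq
    by (intro Cinf_on_sum Cinf_on_mult Cinf_on_uminus Cinf_on_inner op Cinf_on_fderiv r w)
qed

text \<open>Differentiate the Gauss equation and use it again for the second derivatives of \<open>r\<close> that appear.
The antisymmetric part in \<open>l\<close> and \<open>i\<close> of the coefficients in the sum is the curvature tensor.\<close>

lemma third_derivative:
  assumes x: "x \<in> V"
  shows "pd (pd (pd r j) i) l x =
      (\<Sum>k\<in>UNIV. (pd (\<lambda>y. \<Gamma> y i j k) l x + (\<Sum>m\<in>UNIV. \<Gamma> x l m k * \<Gamma> x i j m)) *\<^sub>R pd r k x)
      + G x i j *\<^sub>R pd r l x
      + (pd (\<lambda>y. G y i j) l x + (\<Sum>k\<in>UNIV. \<Gamma> x i j k * G x l k)) *\<^sub>R r x"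
proof -
  let ?e = "axis l 1 :: real^'m"
  have gauss': "((\<lambda>y. (\<Sum>k\<in>UNIV. \<Gamma> y i j k *\<^sub>R pd r k y) + G y i j *\<^sub>R r y) has_derivative
     fderiv (pd (pd r j) i) x) (at x)"
    by (rule has_derivative_transform_within_open[OF Cinf_onD[OF Cinf_on_fderiv[OF Cinf_on_fderiv[OF r]] x] op x gauss])
  have "((\<lambda>y. (\<Sum>k\<in>UNIV. \<Gamma> y i j k *\<^sub>R pd r k y) + G y i j *\<^sub>R r y) has_derivative
      (\<lambda>v. (\<Sum>k\<in>UNIV. \<Gamma> x i j k *\<^sub>R fderiv (pd r k) x v + fderiv (\<lambda>y. \<Gamma> y i j k) x v *\<^sub>R pd r k x) +
        (G x i j *\<^sub>R fderiv r x v + fderiv (\<lambda>y. G y i j) x v *\<^sub>R r x))) (at x)"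
    by (intro has_derivative_add has_derivative_sum has_derivative_scaleR
        Cinf_onD[OF _ x] \<Gamma>_smooth G_smooth r Cinf_on_fderiv)
  from has_derivative_unique[OF gauss' this]
  have "pd (pd (pd r j) i) l x =
      (\<Sum>k\<in>UNIV. \<Gamma> x i j k *\<^sub>R pd (pd r k) l x + pd (\<lambda>y. \<Gamma> y i j k) l x *\<^sub>R pd r k x) +
        (G x i j *\<^sub>R pd r l x + pd (\<lambda>y. G y i j) l x *\<^sub>R r x)"
    by metis
  moreover have "(\<Sum>m\<in>UNIV. \<Gamma> x i j m *\<^sub>R pd (pd r m) l x) =
      (\<Sum>k\<in>UNIV. (\<Sum>m\<in>UNIV. \<Gamma> x l m k * \<Gamma> x i j m) *\<^sub>R pd r k x) + (\<Sum>k\<in>UNIV. \<Gamma> x i j k * G x l k) *\<^sub>R r x"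
  proof -
    have "(\<Sum>m\<in>UNIV. \<Gamma> x i j m *\<^sub>R pd (pd r m) l x) =
       (\<Sum>m\<in>UNIV. \<Sum>k\<in>UNIV. (\<Gamma> x l m k * \<Gamma> x i j m) *\<^sub>R pd r k x) + (\<Sum>k\<in>UNIV. \<Gamma> x i j k * G x l k) *\<^sub>R r x"
      unfolding gauss[OF x]
      by (simp add: scaleR_add_right sum.distrib scaleR_sum_right scaleR_sum_left mult.commute)
    then show ?thesis by (subst (asm) sum.swap) (simp add: scaleR_sum_left)
  qed
  ultimately show ?thesis
    by (simp add: sum.distrib scaleR_add_left algebra_simps)
qed

text \<open>The two mixed third derivatives of \<open>r\<close> coincide. If the curvature coefficients coincided as well,
then the tangent vector \<open>dr(c)\<close> with \<open>c = g\<^sub>b\<^sub>b e\<^sub>a - g\<^sub>a\<^sub>b e\<^sub>b\<close> would be a multiple of the transversal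
vector \<open>r\<close>. This forces \<open>c = 0\<close>, hence \<open>g\<^sub>b\<^sub>b = 0\<close>, against definiteness.\<close>

lemma curvature_components_nonzero:
  assumes x: "x \<in> V" and ab: "a \<noteq> b"
  obtains k where
    "pd (\<lambda>y. \<Gamma> y b b k) a x + (\<Sum>m\<in>UNIV. \<Gamma> x a m k * \<Gamma> x b b m) \<noteq>
     pd (\<lambda>y. \<Gamma> y a b k) b x + (\<Sum>m\<in>UNIV. \<Gamma> x b m k * \<Gamma> x a b m)"
proof (rule ccontr)
  assume "\<not> thesis"
  then have flat: "pd (\<lambda>y. \<Gamma> y b b k) a x + (\<Sum>m\<in>UNIV. \<Gamma> x a m k * \<Gamma> x b b m) =
     pd (\<lambda>y. \<Gamma> y a b k) b x + (\<Sum>m\<in>UNIV. \<Gamma> x b m k * \<Gamma> x a b m)" for k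
    using that by blast
  have lin: "linear (fderiv r x)" using Cinf_onD[OF r x] has_derivative_linear by blast
  define c where "c = G x b b *\<^sub>R axis a 1 - G x a b *\<^sub>R axis b (1::real)"
  define s where "s = (pd (\<lambda>y. G y b b) a x + (\<Sum>k\<in>UNIV. \<Gamma> x b b k * G x a k))
      - (pd (\<lambda>y. G y a b) b x + (\<Sum>k\<in>UNIV. \<Gamma> x a b k * G x b k))"
  have comm: "pd (pd (pd r b) b) a x = pd (pd (pd r b) a) b x"
    by (rule fderiv_commute[OF op Cinf_on_fderiv[OF r] x])
  have "G x b b *\<^sub>R pd r a x - G x a b *\<^sub>R pd r b x + s *\<^sub>R r x = 0"
    using comm unfolding third_derivative[OF x] flat s_def
    by (simp add: scaleR_left_diff_distrib algebra_simps)
  moreover have "fderiv r x c = G x b b *\<^sub>R pd r a x - G x a b *\<^sub>R pd r b x"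
    unfolding c_def by (simp add: linear_diff[OF lin] linear_cmul[OF lin])
  ultimately have "fderiv r x c = (- s) *\<^sub>R r x" by (simp add: add_eq_0_iff)
  then have "fderiv w x c \<bullet> fderiv r x c = 0" using conormal'[OF x] by simp
  then have "c = 0" using neg[OF x, of c] by force
  then have "c $ a = 0" by simp
  then have "G x b b = 0" using ab by (simp add: c_def axis_def)
  moreover have "pd w b x \<bullet> pd r b x < 0" using neg[OF x, of "axis b 1"] by simp
  ultimately show False by (simp add: G_def)
qed

text \<open>The hypothesis \<open>cone\<close> says that the coordinates of the chart are affine coordinates of the
projection of \<open>r\<close> to the hyperplane of coordinate sum 1. By the Gauss equation a geodesic satisfies
\<open>r'' = \<kappa> r\<close>. Write \<open>r = S Q\<close> with \<open>S\<close> the coordinate sum of \<open>r\<close> and \<open>Q = c + A \<gamma>\<close>. Summing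
coordinates gives \<open>S'' = \<kappa> S\<close>, and what is left of \<open>r'' = \<kappa> r\<close> is \<open>2 S' Q' + S Q'' = 0\<close>. Thus
\<open>(S\<^sup>2 \<gamma>')' = 0\<close>, and the velocity of \<open>\<gamma>\<close> is a positive multiple of a constant vector.\<close>

lemma geodesic_straight:
  fixes A :: "real^'m \<Rightarrow> real^'n"
  assumes geo: "geodesic V \<Gamma> J \<gamma>"
    and cone: "\<And>x. x \<in> V \<Longrightarrow> r x = (\<Sum>i\<in>UNIV. r x $ i) *\<^sub>R (c + A x)"
    and A: "linear A" "inj A"
  shows "straight_up_to_time J \<gamma>"
proof -
  obtain \<gamma>' \<gamma>'' where J: "open J" "is_interval J" and inV: "\<And>t. t \<in> J \<Longrightarrow> \<gamma> t \<in> V"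
    and d1: "\<And>t. t \<in> J \<Longrightarrow> (\<gamma> has_vector_derivative \<gamma>' t) (at t)"
    and d2: "\<And>t. t \<in> J \<Longrightarrow> (\<gamma>' has_vector_derivative \<gamma>'' t) (at t)"
    and eqn: "\<And>t k. t \<in> J \<Longrightarrow> \<gamma>'' t $ k +
          (\<Sum>i\<in>UNIV. \<Sum>j\<in>UNIV. \<Gamma> (\<gamma> t) i j k * \<gamma>' t $ i * \<gamma>' t $ j) = 0"
    using geo unfolding geodesic_def by blast
  have conv: "convex J" using J(2) is_interval_convex by blast
  define S where "S t = (\<Sum>i\<in>UNIV. r (\<gamma> t) $ i)" for t
  have S0: "S t \<noteq> 0" if "t \<in> J" for t
  proof
    assume "S t = 0"
    then have "r (\<gamma> t) = 0" using cone[OF inV[OF that]] by (simp add: S_def)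
    then show False using pair[OF inV[OF that]] by simp
  qed
  have along: "((\<lambda>t. f (\<gamma> t)) has_vector_derivative fderiv f (\<gamma> t) (\<gamma>' t)) (at t)"
    if "t \<in> J" "Cinf_on V f" for t and f :: "real^'m \<Rightarrow> real^'n"
    using vector_derivative_diff_chain_within[of \<gamma> "\<gamma>' t" t UNIV f "fderiv f (\<gamma> t)"]
      d1[OF that(1)] has_derivative_at_withinI[OF Cinf_onD[OF that(2) inV[OF that(1)]]]
    by (simp add: o_def)
  define R where "R t = fderiv r (\<gamma> t) (\<gamma>' t)" for t
  have R: "((\<lambda>t. r (\<gamma> t)) has_vector_derivative R t) (at t)" if "t \<in> J" for t
    unfolding R_def using along[OF that r] .
  define \<kappa> where "\<kappa> t = (\<Sum>j\<in>UNIV. \<Sum>i\<in>UNIV. G (\<gamma> t) i j * \<gamma>' t $ i * \<gamma>' t $ j)" for t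
  have R': "(R has_vector_derivative \<kappa> t *\<^sub>R r (\<gamma> t)) (at t)" if t: "t \<in> J" for t
  proof -
    have comp: "((\<lambda>t. \<gamma>' t $ j) has_real_derivative \<gamma>'' t $ j) (at t)" for j
      using bounded_linear.has_vector_derivative[OF bounded_linear_vec_nth d2[OF t]]
      by (simp add: has_real_derivative_iff_has_vector_derivative)
    have D: "((\<lambda>t. \<Sum>j\<in>UNIV. \<gamma>' t $ j *\<^sub>R pd r j (\<gamma> t)) has_vector_derivative
       (\<Sum>j\<in>UNIV. \<gamma>' t $ j *\<^sub>R fderiv (pd r j) (\<gamma> t) (\<gamma>' t) + \<gamma>'' t $ j *\<^sub>R pd r j (\<gamma> t))) (at t)"
      by (intro has_vector_derivative_sum has_vector_derivative_scaleR comp along[OF t] Cinf_on_fderiv r)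
    have "(\<Sum>j\<in>UNIV. \<gamma>' t $ j *\<^sub>R fderiv (pd r j) (\<gamma> t) (\<gamma>' t)) =
      (\<Sum>j\<in>UNIV. \<Sum>i\<in>UNIV. \<Sum>k\<in>UNIV. (\<Gamma> (\<gamma> t) i j k * \<gamma>' t $ i * \<gamma>' t $ j) *\<^sub>R pd r k (\<gamma> t))
       + \<kappa> t *\<^sub>R r (\<gamma> t)"
      unfolding fderiv_eq_sum_pd[OF Cinf_onD[OF Cinf_on_fderiv[OF r] inV[OF t]], of _ "\<gamma>' t"] gauss[OF inV[OF t]] \<kappa>_def
      by (simp add: scaleR_add_right sum.distrib scaleR_sum_right scaleR_sum_left mult_ac)
    also have "(\<Sum>j\<in>UNIV. \<Sum>i\<in>UNIV. \<Sum>k\<in>UNIV. (\<Gamma> (\<gamma> t) i j k * \<gamma>' t $ i * \<gamma>' t $ j) *\<^sub>R pd r k (\<gamma> t))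
      = (\<Sum>k\<in>UNIV. (\<Sum>i\<in>UNIV. \<Sum>j\<in>UNIV. \<Gamma> (\<gamma> t) i j k * \<gamma>' t $ i * \<gamma>' t $ j) *\<^sub>R pd r k (\<gamma> t))"
      unfolding scaleR_sum_left
      by (subst sum.swap, subst (2) sum.swap, subst sum.swap) (rule refl)
    also have "(\<lambda>k. \<Sum>i\<in>UNIV. \<Sum>j\<in>UNIV. \<Gamma> (\<gamma> t) i j k * \<gamma>' t $ i * \<gamma>' t $ j) = (\<lambda>k. - \<gamma>'' t $ k)"
      using eqn[OF t] by (simp add: fun_eq_iff eq_neg_iff_add_eq_0 add.commute)
    finally have "(\<Sum>j\<in>UNIV. \<gamma>' t $ j *\<^sub>R fderiv (pd r j) (\<gamma> t) (\<gamma>' t) + \<gamma>'' t $ j *\<^sub>R pd r j (\<gamma> t)) = \<kappa> t *\<^sub>R r (\<gamma> t)"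
      by (simp add: sum.distrib sum_negf)
    with D have "((\<lambda>t. \<Sum>j\<in>UNIV. \<gamma>' t $ j *\<^sub>R pd r j (\<gamma> t)) has_vector_derivative \<kappa> t *\<^sub>R r (\<gamma> t)) (at t)"
      by simp
    then show ?thesis
      by (rule has_vector_derivative_transform_within_open[OF _ J(1) t])
        (simp add: R_def fderiv_eq_sum_pd[OF Cinf_onD[OF r inV]])
  qed
  have bl: "bounded_linear (\<lambda>z::real^'n. \<Sum>i\<in>UNIV. z $ i)"
    by (intro bounded_linear_sum bounded_linear_vec_nth)
  define S' where "S' t = (\<Sum>i\<in>UNIV. R t $ i)" for t
  have dS: "(S has_real_derivative S' t) (at t)" "(S' has_real_derivative \<kappa> t * S t) (at t)" if "t \<in> J" for t
    using bounded_linear.has_vector_derivative[OF bl R[OF that]]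
      bounded_linear.has_vector_derivative[OF bl R'[OF that]]
    by (simp_all add: has_real_derivative_iff_has_vector_derivative S_def[abs_def] S'_def[abs_def] sum_distrib_left)
  have blA: "bounded_linear A" using A(1) linear_conv_bounded_linear by blast
  define Q where "Q t = c + A (\<gamma> t)" for t
  have dQ: "(Q has_vector_derivative A (\<gamma>' t)) (at t)" "((\<lambda>t. A (\<gamma>' t)) has_vector_derivative A (\<gamma>'' t)) (at t)"
    if "t \<in> J" for t
    using has_vector_derivative_add[OF has_vector_derivative_const bounded_linear.has_vector_derivative[OF blA d1[OF that]], of c]
      bounded_linear.has_vector_derivative[OF blA d2[OF that]]
    by (simp_all add: Q_def[abs_def])
  have rQ: "r (\<gamma> t) = S t *\<^sub>R Q t" if "t \<in> J" for t
    using cone[OF inV[OF that]] by (simp add: S_def Q_def)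
  have R_eq: "R t = S t *\<^sub>R A (\<gamma>' t) + S' t *\<^sub>R Q t" if "t \<in> J" for t
  proof -
    have "((\<lambda>t. S t *\<^sub>R Q t) has_vector_derivative S t *\<^sub>R A (\<gamma>' t) + S' t *\<^sub>R Q t) (at t)"
      by (intro has_vector_derivative_scaleR dS dQ that)
    then have "((\<lambda>t. r (\<gamma> t)) has_vector_derivative S t *\<^sub>R A (\<gamma>' t) + S' t *\<^sub>R Q t) (at t)"
      by (rule has_vector_derivative_transform_within_open[OF _ J(1) that]) (simp add: rQ)
    from vector_derivative_unique_at[OF R[OF that] this] show ?thesis .
  qed
  have key: "(2 * S' t) *\<^sub>R \<gamma>' t + S t *\<^sub>R \<gamma>'' t = 0" if "t \<in> J" for t
  proof -
    have "((\<lambda>t. S t *\<^sub>R A (\<gamma>' t) + S' t *\<^sub>R Q t) has_vector_derivative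
       (S t *\<^sub>R A (\<gamma>'' t) + S' t *\<^sub>R A (\<gamma>' t)) + (S' t *\<^sub>R A (\<gamma>' t) + (\<kappa> t * S t) *\<^sub>R Q t)) (at t)"
      by (intro has_vector_derivative_add has_vector_derivative_scaleR dS dQ that)
    then have "(R has_vector_derivative
       (S t *\<^sub>R A (\<gamma>'' t) + S' t *\<^sub>R A (\<gamma>' t)) + (S' t *\<^sub>R A (\<gamma>' t) + (\<kappa> t * S t) *\<^sub>R Q t)) (at t)"
      by (rule has_vector_derivative_transform_within_open[OF _ J(1) that]) (simp add: R_eq)
    from vector_derivative_unique_at[OF R'[OF that] this]
    have "S t *\<^sub>R A (\<gamma>'' t) + S' t *\<^sub>R A (\<gamma>' t) + S' t *\<^sub>R A (\<gamma>' t) = 0"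
      unfolding rQ[OF that] by (simp add: add.assoc[symmetric])
    moreover have "(2 * S' t) *\<^sub>R A (\<gamma>' t) = S' t *\<^sub>R A (\<gamma>' t) + S' t *\<^sub>R A (\<gamma>' t)"
      by (simp flip: scaleR_left_distrib)
    ultimately have "S t *\<^sub>R A (\<gamma>'' t) + (2 * S' t) *\<^sub>R A (\<gamma>' t) = 0"
      by (simp add: add.assoc)
    then have "A ((2 * S' t) *\<^sub>R \<gamma>' t + S t *\<^sub>R \<gamma>'' t) = 0"
      by (simp add: linear_add[OF A(1)] linear_cmul[OF A(1)] add.commute)
    then show ?thesis using A linear_injective_0 by blast
  qed
  have "((\<lambda>t. (S t * S t) *\<^sub>R \<gamma>' t) has_vector_derivative 0) (at t within J)" if "t \<in> J" for t
  proof -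
    have "((\<lambda>t. (S t * S t) *\<^sub>R \<gamma>' t) has_vector_derivative
      (S t * S t) *\<^sub>R \<gamma>'' t + (S' t * S t + S t * S' t) *\<^sub>R \<gamma>' t) (at t)"
      using has_vector_derivative_scaleR[OF DERIV_mult[OF dS(1)[OF that] dS(1)[OF that]] d2[OF that]]
      by (simp add: mult.commute)
    moreover have "(S t * S t) *\<^sub>R \<gamma>'' t + (S' t * S t + S t * S' t) *\<^sub>R \<gamma>' t
       = S t *\<^sub>R ((2 * S' t) *\<^sub>R \<gamma>' t + S t *\<^sub>R \<gamma>'' t)"
      by (simp add: algebra_simps scaleR_2 flip: scaleR_left_distrib)
    ultimately show ?thesis
      using key[OF that] by (simp add: has_vector_derivative_at_within)
  qed
  from has_vector_derivative_zero_constant[OF conv this]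
  obtain v where v: "\<And>t. t \<in> J \<Longrightarrow> (S t * S t) *\<^sub>R \<gamma>' t = v" by metis
  define \<sigma> where "\<sigma> t = 1 / (S t * S t)" for t
  have vel: "\<gamma>' t = \<sigma> t *\<^sub>R v" "\<sigma> t > 0" if "t \<in> J" for t
  proof -
    have "S t * S t > 0" using S0[OF that] not_real_square_gt_zero by blast
    then show "\<gamma>' t = \<sigma> t *\<^sub>R v" "\<sigma> t > 0"
      unfolding v[OF that, symmetric] \<sigma>_def by auto
  qed
  show ?thesis
  proof (cases "v = 0 \<or> J = {}")
    case True
    then have "(\<gamma> has_vector_derivative 0) (at t within J)" if "t \<in> J" for t
      using d1[OF that] vel(1)[OF that] that by (auto simp: has_vector_derivative_at_within)
    from has_vector_derivative_zero_constant[OF conv this]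
    obtain p where "\<And>t. t \<in> J \<Longrightarrow> \<gamma> t = p" by metis
    then have "(\<exists>d>0. ((\<lambda>t. t) has_real_derivative d) (at t)) \<and> \<gamma> t = p + t *\<^sub>R 0" if "t \<in> J" for t
      using that by (auto intro!: exI[of _ 1])
    then show ?thesis unfolding straight_up_to_time_def by blast
  next
    case False
    then obtain t0 where t0: "t0 \<in> J" and v0: "v \<noteq> 0" by blast
    \<comment> \<open>the time change is recovered by projecting the curve to the direction \<open>v\<close>\<close>
    define s where "s t = (\<gamma> t - \<gamma> t0) \<bullet> v / (v \<bullet> v)" for t
    have ds: "(s has_real_derivative \<sigma> t) (at t)" if "t \<in> J" for t
    proof -
      have "bounded_linear (\<lambda>z. z \<bullet> v / (v \<bullet> v))"
        by (intro bounded_linear_compose[OF bounded_linear_divide bounded_linear_inner_left])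
      from bounded_linear.has_vector_derivative[OF this has_vector_derivative_diff[OF d1[OF that] has_vector_derivative_const[of "\<gamma> t0"]]]
      show ?thesis
        using v0 by (simp add: has_real_derivative_iff_has_vector_derivative s_def[abs_def] vel[OF that])
    qed
    have "((\<lambda>t. \<gamma> t - s t *\<^sub>R v) has_vector_derivative 0) (at t within J)" if "t \<in> J" for t
    proof -
      have "((\<lambda>t. \<gamma> t - s t *\<^sub>R v) has_vector_derivative \<gamma>' t - (s t *\<^sub>R 0 + \<sigma> t *\<^sub>R v)) (at t)"
        by (intro has_vector_derivative_diff has_vector_derivative_scaleR ds d1 that has_vector_derivative_const)
      then show ?thesis by (simp add: vel[OF that] has_vector_derivative_at_within)
    qed
    from has_vector_derivative_zero_constant[OF conv this]
    obtain p where "\<And>t. t \<in> J \<Longrightarrow> \<gamma> t - s t *\<^sub>R v = p" by metis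
    then have "(\<exists>d>0. (s has_real_derivative d) (at t)) \<and> \<gamma> t = p + s t *\<^sub>R v" if "t \<in> J" for t
      using ds[OF that] vel(2)[OF that] that by (auto simp: algebra_simps)
    then show ?thesis unfolding straight_up_to_time_def by blast
  qed
qed

end

text \<open>Conormal pairs exist in every coordinate system once they exist in one.\<close>

lemma (in conormal_pair) pullback:
  fixes S :: "(real^'m) set"
  assumes "open S" "Cinf_on S h" "h ` S \<subseteq> V" "\<And>x v. x \<in> S \<Longrightarrow> fderiv h x v = 0 \<Longrightarrow> v = 0"
  shows "conormal_pair S (\<lambda>x. r (h x)) (\<lambda>x. w (h x))"
proof
  have D: "fderiv (\<lambda>x. r (h x)) x v = fderiv r (h x) (fderiv h x v)"
     "fderiv (\<lambda>x. w (h x)) x v = fderiv w (h x) (fderiv h x v)" if "x \<in> S" for x v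
    using fderiv_compose[OF r assms(2) that] fderiv_compose[OF w assms(2) that] assms(3) that by blast+
  have hV: "h x \<in> V" if "x \<in> S" for x using that assms(3) by blast
  show "w (h x) \<bullet> fderiv (\<lambda>x. r (h x)) x v = 0" if "x \<in> S" for x v
    using D(1)[OF that] conormal hV[OF that] by simp
  show "fderiv (\<lambda>x. w (h x)) x v \<bullet> fderiv (\<lambda>x. r (h x)) x v < 0" if "x \<in> S" "v \<noteq> 0" for x v
    using D[OF that(1)] neg[OF hV[OF that(1)]] assms(4) that by metis
qed (use dim assms r w pair in \<open>auto intro: Cinf_on_compose\<close>)

lemma geodesic_cong:
  assumes "\<And>x i j k. x \<in> V \<Longrightarrow> D x i j k = E x i j k" "geodesic V D J \<gamma>"
  shows "geodesic V E J \<gamma>"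
proof -
  have "D (\<gamma> t) = E (\<gamma> t)" if "t \<in> J" for t
    using assms that by (auto simp: geodesic_def fun_eq_iff)
  moreover obtain \<gamma>' \<gamma>'' where "open J" "is_interval J" "\<gamma> ` J \<subseteq> V"
    "\<forall>t\<in>J. (\<gamma> has_vector_derivative \<gamma>' t) (at t) \<and> (\<gamma>' has_vector_derivative \<gamma>'' t) (at t) \<and>
      (\<forall>k. \<gamma>'' t $ k + (\<Sum>i\<in>UNIV. \<Sum>j\<in>UNIV. D (\<gamma> t) i j k * \<gamma>' t $ i * \<gamma>' t $ j) = 0)"
    using assms(2) unfolding geodesic_def by blast
  ultimately show ?thesis
    unfolding geodesic_def by (intro conjI exI[of _ \<gamma>'] exI[of _ \<gamma>'']) simp_all
qed

lemma sum_axis: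
  fixes f :: "'m::finite \<Rightarrow> real"
  shows "(\<Sum>i\<in>UNIV. axis a 1 $ i * f i) = f a"
proof -
  have "(\<Sum>i\<in>UNIV. axis a 1 $ i * f i) = (\<Sum>i\<in>UNIV. if i = a then f i else 0)"
    by (intro sum.cong refl) (simp add: axis_def)
  then show ?thesis by simp
qed

lemma sum_axis2:
  fixes f :: "'m::finite \<Rightarrow> 'm \<Rightarrow> real"
  shows "(\<Sum>i\<in>UNIV. \<Sum>j\<in>UNIV. f i j * axis a 1 $ i * g j) = (\<Sum>j\<in>UNIV. f a j * g j)"
  by (subst sum.swap) (simp only: mult.commute[of "f _ _"] mult.assoc sum_axis)

lemma covariant_deriv_const:
  fixes \<Gamma> :: "'m::finite christoffel"
  shows "covariant_deriv \<Gamma> (\<lambda>_. axis a 1) (\<lambda>_. axis b 1) = (\<lambda>x. \<chi> k. \<Gamma> x a b k)"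
proof -
  have "partial_deriv i (\<lambda>y. c) x = 0" for i and x :: "real^'m" and c :: real
    by (rule partial_deriv_eq[of _ "\<lambda>_. 0"]) simp
  then show ?thesis
    by (simp add: fun_eq_iff covariant_deriv_def vec_eq_iff sum_axis2)
      (simp add: mult.commute[of "\<Gamma> _ _ _ _"] sum_axis)
qed

text \<open>For coordinate vector fields the bracket vanishes and the curvature is given by the Christoffel
symbols alone. The connection is an arbitrary \<open>D\<close> because the symbols of the divergence agree with
\<open>\<Gamma>\<close> on the chart domain only.\<close>

lemma (in conormal_pair) curvature_nonzero:
  assumes eq: "\<And>x i j k. x \<in> V \<Longrightarrow> D x i j k = \<Gamma> x i j k"
    and x: "x \<in> V" and ab: "a \<noteq> b"
  shows "curvature D (\<lambda>_. axis a 1) (\<lambda>_. axis b 1) (\<lambda>_. axis b 1) x \<noteq> 0"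
proof -
  have cov: "covariant_deriv D (\<lambda>_. axis l 1) (\<lambda>y. \<chi> k. D y i j k) x $ k =
      pd (\<lambda>y. \<Gamma> y i j k) l x + (\<Sum>m\<in>UNIV. \<Gamma> x l m k * \<Gamma> x i j m)" for i j k l
  proof -
    have "partial_deriv l (\<lambda>y. D y i j k) x = partial_deriv l (\<lambda>y. \<Gamma> y i j k) x"
      by (rule partial_deriv_cong[OF op x eq])
    also have "\<dots> = pd (\<lambda>y. \<Gamma> y i j k) l x"
      by (rule partial_deriv_eq[OF Cinf_onD[OF \<Gamma>_smooth x]])
    finally show ?thesis
      by (simp add: covariant_deriv_def sum_axis sum_axis2 eq[OF x])
  qed
  have bracket: "lie_bracket (\<lambda>_. axis a 1) (\<lambda>_. axis b 1) = (\<lambda>_. 0 :: real^'m)"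
  proof -
    have "partial_deriv i (\<lambda>y. c) x = 0" for i and x :: "real^'m" and c :: real
      by (rule partial_deriv_eq[of _ "\<lambda>_. 0"]) simp
    then show ?thesis by (simp add: fun_eq_iff lie_bracket_def vec_eq_iff)
  qed
  have zero: "covariant_deriv D (\<lambda>_. 0) Z x = 0" for Z
    by (simp add: covariant_deriv_def vec_eq_iff)
  obtain k where "pd (\<lambda>y. \<Gamma> y b b k) a x + (\<Sum>m\<in>UNIV. \<Gamma> x a m k * \<Gamma> x b b m) \<noteq>
     pd (\<lambda>y. \<Gamma> y a b k) b x + (\<Sum>m\<in>UNIV. \<Gamma> x b m k * \<Gamma> x a b m)"
    using curvature_components_nonzero[OF x ab] .
  then have "curvature D (\<lambda>_. axis a 1) (\<lambda>_. axis b 1) (\<lambda>_. axis b 1) x $ k \<noteq> 0"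
    by (simp add: curvature_def covariant_deriv_const bracket zero cov)
  then show ?thesis by force
qed

lemma (in conormal_pair) not_curvature_vanishes:
  assumes "\<And>x i j k. x \<in> V \<Longrightarrow> D x i j k = \<Gamma> x i j k" "V \<noteq> {}" "CARD('m) \<ge> 2"
  shows "\<not> curvature_vanishes V D"
proof -
  have "\<not> is_singleton (UNIV :: 'm set)" using assms(3) by (simp add: is_singleton_altdef)
  then obtain a b :: 'm where "a \<noteq> b" by (metis UNIV_I is_singletonI' empty_iff)
  moreover obtain x where x: "x \<in> V" using assms(2) by blast
  ultimately have "curvature D (\<lambda>_. axis a 1) (\<lambda>_. axis b 1) (\<lambda>_. axis b 1) x \<noteq> 0"
    using curvature_nonzero assms(1) by blast
  then show ?thesis
    using x smooth_on_const unfolding curvature_vanishes_def by blast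
qed

section \<open>The connections of a logarithmic divergence\<close>

text \<open>The shape taken by all second logarithmic derivatives. At a diagonal point the values are
\<open>B = 1\<close> and \<open>C = D = 0\<close>, so the quadratic term contributes nothing.\<close>

lemma partial_deriv_quotients:
  fixes A :: "real^'m \<Rightarrow> real"
  assumes "(A has_derivative A') (at x)" "(B has_derivative B') (at x)"
    "(C has_derivative C') (at x)" "(D has_derivative D') (at x)"
    and "B x = 1" "C x = 0" "D x = 0"
  shows "partial_deriv i (\<lambda>y. A y / B y - C y * D y / (B y)\<^sup>2) x = A' (axis i 1) - A x * B' (axis i 1)"
proof -
  have "((\<lambda>y. A y / B y - C y * D y / (B y)\<^sup>2) has_derivative (\<lambda>v. A' v - A x * B' v)) (at x)"
    using assms(5-7)
    by (auto intro!: derivative_eq_intros assms(1-4) simp: power2_eq_square)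
  then show ?thesis by (rule partial_deriv_eq)
qed

lemma has_derivative_quotient:
  fixes A B :: "'a::real_normed_vector \<Rightarrow> real"
  assumes "(A has_derivative A') (at x)" "(B has_derivative B') (at x)" "B x > 0"
  shows "((\<lambda>y. A y / B y) has_derivative (\<lambda>v. A' v / B x - A x * B' v / (B x)\<^sup>2)) (at x)"
  using assms(3) by (auto intro!: derivative_eq_intros assms(1,2) simp: field_simps power2_eq_square)

lemma has_derivative_ln_compose:
  fixes A :: "'a::real_normed_vector \<Rightarrow> real"
  assumes "(A has_derivative A') (at x)" "A x > 0"
  shows "((\<lambda>y. ln (A y)) has_derivative (\<lambda>v. A' v / A x)) (at x)"
  using assms(2) by (auto intro!: derivative_eq_intros assms(1) simp: field_simps)

locale conormal_divergence = conormal_pair V r w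
  for V :: "(real^'m) set" and r w :: "real^'m \<Rightarrow> real^'n" +
  fixes \<phi> :: "real^'n \<Rightarrow> real" and \<xi> :: "real^'n \<Rightarrow> real^'m"
  assumes pos: "\<And>x x'. x \<in> V \<Longrightarrow> x' \<in> V \<Longrightarrow> w x' \<bullet> r x > 0"
    and divergence: "\<And>x x'. x \<in> V \<Longrightarrow> x' \<in> V \<Longrightarrow> coord_divergence \<phi> \<xi> x x' = ln (w x' \<bullet> r x)"
begin

lemma inner_has_derivative:
  fixes f g :: "real^'m \<Rightarrow> real^'n"
  assumes "x \<in> V"
  shows "Cinf_on V f \<Longrightarrow> ((\<lambda>y. a \<bullet> f y) has_derivative (\<lambda>v. a \<bullet> fderiv f x v)) (at x)"
    and "Cinf_on V f \<Longrightarrow> ((\<lambda>y. f y \<bullet> a) has_derivative (\<lambda>v. fderiv f x v \<bullet> a)) (at x)"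
  using has_derivative_inner_right[OF Cinf_onD[of V f, OF _ assms]]
    has_derivative_inner_left[OF Cinf_onD[of V f, OF _ assms]] by blast+

lemma first_partial:
  assumes "z \<in> V" "x \<in> V"
  shows "partial_deriv k (\<lambda>y'. coord_divergence \<phi> \<xi> z y') x = (pd w k x \<bullet> r z) / (w x \<bullet> r z)"
proof -
  have "((\<lambda>y'. ln (w y' \<bullet> r z)) has_derivative (\<lambda>v. (fderiv w x v \<bullet> r z) / (w x \<bullet> r z))) (at x)"
    by (intro has_derivative_ln_compose inner_has_derivative(2) pos assms w)
  from partial_deriv_eq[OF this] show ?thesis
    by (subst partial_deriv_cong[OF op assms(2) divergence[OF assms(1)]])
qed

lemma L_metric_eq:
  assumes x: "x \<in> V"
  shows "L_metric \<phi> \<xi> x i j = G x i j"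
proof -
  have "partial_deriv i (\<lambda>y. partial_deriv j (\<lambda>y'. coord_divergence \<phi> \<xi> y y') x) x =
     partial_deriv i (\<lambda>y. (pd w j x \<bullet> r y) / (w x \<bullet> r y) - 0 * 0 / (w x \<bullet> r y)\<^sup>2) x"
    by (rule partial_deriv_cong[OF op x]) (simp add: first_partial x)
  also have "\<dots> = pd w j x \<bullet> pd r i x - (pd w j x \<bullet> r x) * (w x \<bullet> pd r i x)"
    by (rule partial_deriv_quotients[OF inner_has_derivative(1)[OF x r] inner_has_derivative(1)[OF x r]
        has_derivative_const has_derivative_const pair[OF x] refl refl])
  finally show ?thesis using conormal[OF x] by (simp add: L_metric_def G_def)
qed

lemma inverse_metric_eq:
  "x \<in> V \<Longrightarrow> inverse_metric \<phi> \<xi> x i j = matrix_inv (\<chi> a b. G x a b) $ i $ j"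
  by (simp add: inverse_metric_def L_metric_eq)

text \<open>Of the terms of \<open>\<partial>'\<^sub>k \<partial>\<^sub>i \<partial>\<^sub>j ln (w(x') \<bullet> r(x))\<close> only the one with the second derivative of \<open>r\<close>
survives on the diagonal, since the factors \<open>w \<bullet> \<partial>r\<close> and \<open>\<partial>w \<bullet> r\<close> vanish there.\<close>

lemma primal_lower_eq:
  assumes x: "x \<in> V"
  shows "primal_lower \<phi> \<xi> x i j k = - (pd w k x \<bullet> pd (pd r j) i x)"
proof -
  have "partial_deriv j (\<lambda>z. partial_deriv k (\<lambda>y'. coord_divergence \<phi> \<xi> z y') x) y =
      (pd w k x \<bullet> pd r j y) / (w x \<bullet> r y) - (pd w k x \<bullet> r y) * (w x \<bullet> pd r j y) / (w x \<bullet> r y)\<^sup>2"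
    if y: "y \<in> V" for y
  proof -
    have "((\<lambda>z. (pd w k x \<bullet> r z) / (w x \<bullet> r z)) has_derivative
       (\<lambda>v. (pd w k x \<bullet> fderiv r y v) / (w x \<bullet> r y) -
         (pd w k x \<bullet> r y) * (w x \<bullet> fderiv r y v) / (w x \<bullet> r y)\<^sup>2)) (at y)"
      by (intro has_derivative_quotient inner_has_derivative(1) pos x y r)
    from partial_deriv_eq[OF this] show ?thesis
      by (subst partial_deriv_cong[OF op y first_partial[OF _ x]]) auto
  qed
  then have "partial_deriv i (\<lambda>y. partial_deriv j (\<lambda>z.
      partial_deriv k (\<lambda>y'. coord_divergence \<phi> \<xi> z y') x) y) x =
    partial_deriv i (\<lambda>y. (pd w k x \<bullet> pd r j y) / (w x \<bullet> r y) -
      (pd w k x \<bullet> r y) * (w x \<bullet> pd r j y) / (w x \<bullet> r y)\<^sup>2) x"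
    by (rule partial_deriv_cong[OF op x])
  also have "\<dots> = pd w k x \<bullet> pd (pd r j) i x - (pd w k x \<bullet> pd r j x) * (w x \<bullet> pd r i x)"
    by (rule partial_deriv_quotients[OF inner_has_derivative(1)[OF x] inner_has_derivative(1)[OF x]
        inner_has_derivative(1)[OF x] inner_has_derivative(1)[OF x]])
      (simp_all add: r Cinf_on_fderiv x pair conormal conormal')
  finally show ?thesis using conormal[OF x] by (simp add: primal_lower_def)
qed

lemma dual_lower_eq:
  assumes x: "x \<in> V"
  shows "dual_lower \<phi> \<xi> x i j k = - (pd (pd w j) i x \<bullet> pd r k x)"
proof -
  have "partial_deriv i (\<lambda>y'. partial_deriv j (\<lambda>z'. coord_divergence \<phi> \<xi> y z') y') x =
      (pd (pd w j) i x \<bullet> r y) / (w x \<bullet> r y) - (pd w j x \<bullet> r y) * (pd w i x \<bullet> r y) / (w x \<bullet> r y)\<^sup>2"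
    if y: "y \<in> V" for y
  proof -
    have "((\<lambda>y'. (pd w j y' \<bullet> r y) / (w y' \<bullet> r y)) has_derivative
       (\<lambda>v. (fderiv (pd w j) x v \<bullet> r y) / (w x \<bullet> r y) -
         (pd w j x \<bullet> r y) * (fderiv w x v \<bullet> r y) / (w x \<bullet> r y)\<^sup>2)) (at x)"
      by (intro has_derivative_quotient inner_has_derivative(2) pos x y w Cinf_on_fderiv)
    from partial_deriv_eq[OF this] show ?thesis
      by (subst partial_deriv_cong[OF op x first_partial[OF y]]) auto
  qed
  then have "partial_deriv k (\<lambda>y. partial_deriv i (\<lambda>y'.
      partial_deriv j (\<lambda>z'. coord_divergence \<phi> \<xi> y z') y') x) x =
    partial_deriv k (\<lambda>y. (pd (pd w j) i x \<bullet> r y) / (w x \<bullet> r y) -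
      (pd w j x \<bullet> r y) * (pd w i x \<bullet> r y) / (w x \<bullet> r y)\<^sup>2) x"
    by (rule partial_deriv_cong[OF op x])
  also have "\<dots> = pd (pd w j) i x \<bullet> pd r k x - (pd (pd w j) i x \<bullet> r x) * (w x \<bullet> pd r k x)"
    by (rule partial_deriv_quotients[OF inner_has_derivative(1)[OF x r] inner_has_derivative(1)[OF x r]
        inner_has_derivative(1)[OF x r] inner_has_derivative(1)[OF x r]])
      (simp_all add: x pair conormal')
  finally show ?thesis using conormal[OF x] by (simp add: dual_lower_def)
qed

lemma primal_connection_eq:
  "x \<in> V \<Longrightarrow> primal_connection \<phi> \<xi> x i j k = christoffel_pair r w x i j k"
  by (simp add: primal_connection_def primal_lower_eq inverse_metric_eq \<Gamma>_eq)

text \<open>Here symmetry of the metric is needed: exchanging \<open>r\<close> and \<open>w\<close> transposes its matrix.\<close>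

lemma dual_connection_eq:
  assumes "x \<in> V"
  shows "dual_connection \<phi> \<xi> x i j k = christoffel_pair w r x i j k"
proof -
  have "(\<chi> a b. G x a b) = (\<chi> a b. - (pd r b x \<bullet> pd w a x))"
    using G_commute[OF assms] by (simp add: G_def inner_commute)
  then show ?thesis
    by (simp add: dual_connection_def dual_lower_eq inverse_metric_eq assms christoffel_pair_def inner_commute)
qed

end

section \<open>Affine charts of the simplex\<close>

text \<open>Coordinates on the simplex obtained by omitting one barycentric coordinate: \<open>e\<close> enumerates the
vertices other than \<open>apex\<close>.\<close>

locale simplex_chart =
  fixes e :: "'m::finite \<Rightarrow> 'n::finite" and apex :: 'n
  assumes bij: "bij_betw e UNIV (UNIV - {apex})"
begin

definition proj :: "real^'n \<Rightarrow> real^'m" where "proj p = (\<chi> j. p $ e j)"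

text \<open>The linear part of the affine parametrisation \<open>lift\<close> of the hyperplane of coordinate sum 1; its
range consists of the vectors of coordinate sum 0.\<close>

definition incl :: "real^'m \<Rightarrow> real^'n"
  where "incl v = (\<Sum>j\<in>UNIV. v $ j *\<^sub>R (axis (e j) 1 - axis apex 1))"

definition lift :: "real^'m \<Rightarrow> real^'n" where "lift x = axis apex 1 + incl x"

definition U :: "(real^'m) set" where "U = {x. lift x \<in> open_simplex}"

lemma e_neq_apex: "e j \<noteq> apex" "apex \<noteq> e j"
  using bij bij_betwE by fastforce+

lemma e_eq_iff: "e i = e j \<longleftrightarrow> i = j"
  using bij by (auto simp: bij_betw_def inj_on_def)

lemma card_eq: "CARD('n) = CARD('m) + 1"
  using bij_betw_same_card[OF bij] by (simp add: card_Diff_singleton)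

lemma proj_linear: "bounded_linear proj"
proof -
  have "linear proj" by (rule linearI) (simp_all add: proj_def vec_eq_iff)
  then show ?thesis by (simp add: linear_conv_bounded_linear)
qed

lemma incl_linear: "linear incl"
  by (rule linearI)
    (simp_all add: incl_def scaleR_left_distrib sum.distrib scaleR_sum_right)

lemma incl_bounded_linear: "bounded_linear incl"
  using incl_linear by (simp add: linear_conv_bounded_linear)

lemma incl_nth: "incl v $ e j = v $ j"
proof -
  have "incl v $ e j = (\<Sum>i\<in>UNIV. if i = j then v $ i else 0)"
    unfolding incl_def sum_component
    by (intro sum.cong refl) (simp add: axis_def e_neq_apex e_eq_iff)
  then show ?thesis by simp
qed

lemma proj_incl [simp]: "proj (incl v) = v"
  by (simp add: proj_def vec_eq_iff incl_nth)

lemma lift_nth: "lift x $ e j = x $ j"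
  by (simp add: lift_def incl_nth axis_def e_neq_apex)

lemma proj_lift [simp]: "proj (lift x) = x"
  by (simp add: proj_def vec_eq_iff lift_nth)

lemma sum_axis_one: "(\<Sum>a\<in>UNIV. axis b (1::real) $ (a::'n)) = 1"
  by (simp add: axis_def)

lemma sum_incl: "(\<Sum>a\<in>UNIV. incl v $ a) = 0"
  unfolding incl_def sum_component
  by (subst sum.swap) (simp add: sum_subtractf sum_axis_one flip: sum_distrib_left)

lemma sum_lift: "(\<Sum>a\<in>UNIV. lift x $ a) = 1"
  by (simp add: lift_def sum.distrib sum_incl sum_axis_one)

lemma lift_proj:
  assumes "(\<Sum>a\<in>UNIV. p $ a) = 1"
  shows "lift (proj p) = p"
proof -
  have *: "lift (proj p) $ a = p $ a" if "a \<noteq> apex" for a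
  proof -
    have "a \<in> range e" using that bij by (auto simp: bij_betw_def)
    then obtain j where "a = e j" by blast
    then show ?thesis by (simp add: lift_nth proj_def)
  qed
  have "(\<Sum>a\<in>UNIV. lift (proj p) $ a) = (\<Sum>a\<in>UNIV. p $ a)" by (simp add: sum_lift assms)
  then have "lift (proj p) $ apex + (\<Sum>a\<in>UNIV - {apex}. lift (proj p) $ a) = p $ apex + (\<Sum>a\<in>UNIV - {apex}. p $ a)"
    by (simp add: sum.remove[of UNIV apex])
  then have "lift (proj p) $ apex = p $ apex" using * by simp
  then show ?thesis using * by (metis vec_eq_iff)
qed

lemma lift_proj_simplex: "p \<in> open_simplex \<Longrightarrow> lift (proj p) = p"
  by (simp add: open_simplex_def lift_proj)

lemma lift_in_simplex: "x \<in> U \<Longrightarrow> lift x \<in> open_simplex" by (simp add: U_def)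

lemma proj_image: "proj ` open_simplex = U"
proof
  show "proj ` open_simplex \<subseteq> U" by (auto simp: U_def lift_proj_simplex)
  show "U \<subseteq> proj ` open_simplex" using lift_in_simplex proj_lift by (metis image_eqI subsetI)
qed

lemma lift_add: "lift (x + v) = lift x + incl v"
  by (simp add: lift_def linear_add[OF incl_linear])

lemma lift_eq: "lift y = lift x + incl (y - x)"
  using lift_add[of x "y - x"] by simp

lemma lift_smooth: "open S \<Longrightarrow> Cinf_on S lift"
  unfolding lift_def[abs_def] using Cinf_on_add Cinf_on_const Cinf_on_bounded_linear incl_bounded_linear by blast

lemma open_U: "open U"
proof -
  have eq: "U = (\<Inter>a. lift -` {p. p $ a > 0})"
    using sum_lift by (auto simp: U_def open_simplex_def)
  have "continuous_on UNIV lift"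
    using lift_smooth[OF open_UNIV] unfolding Cinf_on_def by (metis Ck_on.simps(1))
  moreover have "open {p::real^'n. p $ a > 0}" for a
    by (intro open_Collect_less continuous_intros)
  ultimately have "open (lift -` {p. p $ a > 0})" for a by (intro open_vimage)
  then have "open (\<Inter>a. lift -` {p. p $ a > 0})" by (intro open_INT) auto
  then show ?thesis by (simp only: eq)
qed

lemma U_segment:
  assumes "x \<in> U" "y \<in> U" "0 \<le> t" "t \<le> 1"
  shows "x + t *\<^sub>R (y - x) \<in> U"
proof -
  have "lift (x + t *\<^sub>R (y - x)) = (1 - t) *\<^sub>R lift x + t *\<^sub>R lift y"
    unfolding lift_add lift_eq[of y x] linear_cmul[OF incl_linear] by (simp add: algebra_simps)
  moreover have "(1 - t) * lift x $ a + t * lift y $ a > 0" for a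
  proof -
    have "lift x $ a > 0" "lift y $ a > 0" using assms(1,2) by (auto simp: U_def open_simplex_def)
    then show ?thesis using assms(3,4)
      by (cases "t = 0") (auto intro: add_nonneg_pos)
  qed
  ultimately show ?thesis
    using sum_lift[of "x + t *\<^sub>R (y - x)"] by (simp add: U_def open_simplex_def)
qed

text \<open>Derivatives along the simplex, defined without any extension of the function, are ordinary
derivatives in the chart.\<close>

lemma dir_deriv_lift: "dir_deriv F (lift x) (incl v) = dir_deriv (\<lambda>y. F (lift y)) x v"
  by (simp add: dir_deriv_def lift_add linear_cmul[OF incl_linear])

end

section \<open>The tangent hyperplanes of an exponentially concave function\<close>

locale simplex_potential = simplex_chart e apex
  for e :: "'m::finite \<Rightarrow> 'n::finite" and apex :: 'n +
  fixes \<phi> :: "real^'n \<Rightarrow> real"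
  assumes smooth: "smooth_on open_simplex \<phi>"
    and hess: "hessian_negative_definite (\<lambda>p. exp (\<phi> p))"
begin

definition \<Phi> :: "real^'m \<Rightarrow> real" where "\<Phi> x = exp (\<phi> (lift x))"

definition r :: "real^'m \<Rightarrow> real^'n" where "r x = inverse (\<Phi> x) *\<^sub>R lift x"

text \<open>The \<open>a\<close>-th component is the value at vertex \<open>a\<close> of the affine function tangent to \<open>\<Phi>\<close> at \<open>x\<close>. Written
with partial derivatives so that smoothness can be read off.\<close>

definition w :: "real^'m \<Rightarrow> real^'n"
  where "w x = (\<chi> a. \<Phi> x + (\<Sum>i\<in>UNIV. (proj (axis a 1) - x) $ i * pd \<Phi> i x))"

lemma \<phi>_smooth: "Cinf_on U (\<lambda>x. \<phi> (lift x))"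
  by (rule smooth_on_compose_Cinf_on[OF smooth open_U lift_smooth[OF open_U]]) (auto simp: U_def)

lemma \<Phi>_smooth: "Cinf_on U \<Phi>"
  unfolding \<Phi>_def[abs_def] by (rule Cinf_on_exp[OF open_U \<phi>_smooth])

lemma \<Phi>_pos: "\<Phi> x > 0" by (simp add: \<Phi>_def)

lemma r_smooth: "Cinf_on U r"
  unfolding r_def[abs_def] using \<Phi>_pos
  by (intro Cinf_on_scaleR Cinf_on_inverse open_U \<Phi>_smooth lift_smooth) (metis less_irrefl)

lemma w_smooth: "Cinf_on U w"
proof -
  have "Cinf_on U (\<lambda>x. (proj (axis a 1) - x) $ i)" for a i
  proof -
    have "bounded_linear (\<lambda>x::real^'m. - (x $ i))"
      by (intro bounded_linear_minus bounded_linear_vec_nth)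
    from Cinf_on_add[OF open_U Cinf_on_const[OF open_U] Cinf_on_bounded_linear[OF this open_U], of "proj (axis a 1) $ i"]
    show ?thesis by simp
  qed
  then show ?thesis
    unfolding w_def[abs_def]
    by (intro Cinf_on_vec_lambda Cinf_on_add Cinf_on_sum Cinf_on_mult open_U \<Phi>_smooth Cinf_on_fderiv)
qed

text \<open>An affine function is the barycentric combination of its values at the vertices.\<close>

lemma w_lift: "w x \<bullet> lift y = \<Phi> x + (\<Sum>i\<in>UNIV. (y - x) $ i * pd \<Phi> i x)"
proof -
  have d: "(\<Sum>a\<in>UNIV. lift y $ a * (proj (axis a 1) - x) $ i) = (y - x) $ i" for i
  proof -
    have "(\<Sum>a\<in>UNIV. lift y $ a * proj (axis a 1) $ i) = (\<Sum>a\<in>UNIV. if a = e i then lift y $ a else 0)"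
      by (intro sum.cong refl) (auto simp: proj_def axis_def)
    then have "(\<Sum>a\<in>UNIV. lift y $ a * proj (axis a 1) $ i) = y $ i" by (simp add: lift_nth)
    then show ?thesis
      by (simp add: right_diff_distrib sum_subtractf sum_lift flip: sum_distrib_right)
  qed
  have "w x \<bullet> lift y = (\<Sum>a\<in>UNIV. lift y $ a * \<Phi> x) +
      (\<Sum>a\<in>UNIV. \<Sum>i\<in>UNIV. (lift y $ a * (proj (axis a 1) - x) $ i) * pd \<Phi> i x)"
    unfolding inner_vec_def w_def
    by (simp add: distrib_left sum.distrib sum_distrib_left mult_ac inner_real_def del: vector_minus_component)
  also have "(\<Sum>a\<in>UNIV. \<Sum>i\<in>UNIV. (lift y $ a * (proj (axis a 1) - x) $ i) * pd \<Phi> i x)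
      = (\<Sum>i\<in>UNIV. (y - x) $ i * pd \<Phi> i x)"
    by (subst sum.swap) (simp only: d flip: sum_distrib_right)
  finally show ?thesis by (simp add: sum_lift flip: sum_distrib_right)
qed

lemma w_tangent:
  assumes "x \<in> U"
  shows "w x \<bullet> lift y = \<Phi> x + fderiv \<Phi> x (y - x)"
  using fderiv_eq_sum_pd[OF Cinf_onD[OF \<Phi>_smooth assms], of "y - x"] by (simp add: w_lift)

lemma hess_neg:
  assumes x: "x \<in> U" and u: "u \<noteq> 0"
  shows "fderiv (\<lambda>z. fderiv \<Phi> z u) x u < 0"
proof -
  let ?E = "\<lambda>p. exp (\<phi> p)"
  have "incl u \<noteq> 0" using u proj_incl[of u] by (metis bounded_linear.linear proj_linear linear_0)
  then have "hessian ?E (lift x) (incl u) (incl u) < 0"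
    using hess lift_in_simplex[OF x] sum_incl unfolding hessian_negative_definite_def by blast
  also have "hessian ?E (lift x) (incl u) (incl u) = dir_deriv (\<lambda>y. dir_deriv \<Phi> y u) x u"
    unfolding hessian_def dir_deriv_lift by (simp add: \<Phi>_def[abs_def])
  also have "\<dots> = dir_deriv (\<lambda>z. fderiv \<Phi> z u) x u"
    by (rule dir_deriv_cong[OF open_U x]) (rule dir_deriv_eq[OF Cinf_onD[OF \<Phi>_smooth]])
  also have "\<dots> = fderiv (\<lambda>z. fderiv \<Phi> z u) x u"
    by (rule dir_deriv_eq[OF Cinf_onD[OF Cinf_on_fderiv[OF \<Phi>_smooth] x]])
  finally show ?thesis .
qed

text \<open>Strict concavity along the segment from \<open>x\<close> to \<open>y\<close>: by the mean value theorem used twice, the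
difference to the tangent has the sign of a second derivative.\<close>

lemma below_tangent:
  assumes x: "x \<in> U" and y: "y \<in> U" and "x \<noteq> y"
  shows "\<Phi> y < w x \<bullet> lift y"
proof -
  let ?u = "y - x" and ?p = "\<lambda>t. x + t *\<^sub>R (y - x)"
  have p: "?p t \<in> U" if "0 \<le> t" "t \<le> 1" for t using U_segment[OF x y that] .
  have d1: "((\<lambda>t. \<Phi> (?p t)) has_real_derivative fderiv \<Phi> (?p t) ?u) (at t)" if "0 \<le> t" "t \<le> 1" for t
    by (rule has_real_derivative_along_line[OF Cinf_onD[OF \<Phi>_smooth p[OF that]]])
  have d2: "((\<lambda>t. fderiv \<Phi> (?p t) ?u) has_real_derivative fderiv (\<lambda>z. fderiv \<Phi> z ?u) (?p t) ?u) (at t)"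
    if "0 \<le> t" "t \<le> 1" for t
    by (rule has_real_derivative_along_line[where f="\<lambda>z. fderiv \<Phi> z ?u", OF Cinf_onD[OF Cinf_on_fderiv[OF \<Phi>_smooth] p[OF that]]])
  obtain s where s: "0 < s" "s < 1" "\<Phi> (?p 1) - \<Phi> (?p 0) = (1 - 0) * fderiv \<Phi> (?p s) ?u"
    using MVT2[OF zero_less_one d1] by auto
  obtain t where t: "0 < t" "t < s" "fderiv \<Phi> (?p s) ?u - fderiv \<Phi> (?p 0) ?u =
      (s - 0) * fderiv (\<lambda>z. fderiv \<Phi> z ?u) (?p t) ?u"
    using MVT2[OF s(1) d2] s(2) by auto
  have "fderiv (\<lambda>z. fderiv \<Phi> z ?u) (?p t) ?u < 0"
    by (rule hess_neg[OF p]) (use s t assms(3) in auto)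
  then have "fderiv \<Phi> (?p s) ?u < fderiv \<Phi> x ?u"
    using t(3) s(1) mult_pos_neg[of s] by fastforce
  then show ?thesis using s(3) w_tangent[OF x] by simp
qed

lemma w_lift_pos:
  assumes "x \<in> U" "y \<in> U"
  shows "w x \<bullet> lift y > 0"
  using below_tangent[OF assms] w_tangent[OF assms(1), of x] \<Phi>_pos
    linear_0[OF has_derivative_linear[OF Cinf_onD[OF \<Phi>_smooth assms(1)]]]
  by (cases "x = y") (auto intro: less_trans)

lemma w_self: "w x \<bullet> lift x = \<Phi> x"
  by (simp add: w_lift)

lemma w_incl:
  assumes "x \<in> U"
  shows "w x \<bullet> incl u = fderiv \<Phi> x u"
  using w_tangent[OF assms, of "x + u"] w_self[of x] by (simp add: lift_add inner_add_right)

text \<open>In \<open>w x \<bullet> lift y = \<Phi> x + D\<Phi> x (y - x)\<close> the two first-order terms produced by differentiating in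
\<open>x\<close> cancel.\<close>

lemma fderiv_w_lift:
  assumes x: "x \<in> U"
  shows "fderiv w x v \<bullet> lift y = fderiv (\<lambda>z. fderiv \<Phi> z (y - x)) x v"
proof -
  have left: "((\<lambda>x. w x \<bullet> lift y) has_derivative (\<lambda>v. fderiv w x v \<bullet> lift y)) (at x)"
    by (rule has_derivative_inner_left[OF Cinf_onD[OF w_smooth x]])
  have right: "((\<lambda>x. w x \<bullet> lift y) has_derivative
     (\<lambda>v. fderiv \<Phi> x v + (\<Sum>i\<in>UNIV. (y - x) $ i * fderiv (pd \<Phi> i) x v + (0 - v) $ i * pd \<Phi> i x))) (at x)"
    unfolding w_lift
    by (intro has_derivative_add has_derivative_sum has_derivative_mult has_derivative_diff has_derivative_const
        has_derivative_ident bounded_linear.has_derivative[OF bounded_linear_vec_nth] Cinf_onD[OF _ x] \<Phi>_smooth Cinf_on_fderiv)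
  have "fderiv w x v \<bullet> lift y =
      fderiv \<Phi> x v + (\<Sum>i\<in>UNIV. (y - x) $ i * fderiv (pd \<Phi> i) x v + (0 - v) $ i * pd \<Phi> i x)"
    by (rule fun_cong[OF has_derivative_unique[OF left right]])
  also have "\<dots> = (\<Sum>i\<in>UNIV. (y - x) $ i * fderiv (pd \<Phi> i) x v)"
    using fderiv_eq_sum_pd[OF Cinf_onD[OF \<Phi>_smooth x], of v] by (simp add: sum_subtractf)
  also have "\<dots> = fderiv (\<lambda>z. fderiv \<Phi> z (y - x)) x v"
  proof -
    have "((\<lambda>z. \<Sum>i\<in>UNIV. (y - x) $ i *\<^sub>R pd \<Phi> i z) has_derivative
        (\<lambda>v. \<Sum>i\<in>UNIV. (y - x) $ i *\<^sub>R fderiv (pd \<Phi> i) x v)) (at x)"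
      by (intro has_derivative_sum has_derivative_scaleR_right Cinf_onD[OF _ x] \<Phi>_smooth Cinf_on_fderiv)
    then have "((\<lambda>z. fderiv \<Phi> z (y - x)) has_derivative
        (\<lambda>v. \<Sum>i\<in>UNIV. (y - x) $ i *\<^sub>R fderiv (pd \<Phi> i) x v)) (at x)"
      by (rule has_derivative_transform_within_open[OF _ open_U x])
        (rule fderiv_eq_sum_pd[OF Cinf_onD[OF \<Phi>_smooth], symmetric])
    from fderiv_eq[OF this] show ?thesis by simp
  qed
  finally show ?thesis .
qed

lemma fderiv_r:
  assumes x: "x \<in> U"
  shows "fderiv r x v = inverse (\<Phi> x) *\<^sub>R incl v - (fderiv \<Phi> x v / (\<Phi> x)\<^sup>2) *\<^sub>R lift x"
proof -
  have "(lift has_derivative incl) (at x)"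
    unfolding lift_def[abs_def] using has_derivative_add[OF has_derivative_const bounded_linear_imp_has_derivative[OF incl_bounded_linear]] by simp
  moreover have "((\<lambda>x. inverse (\<Phi> x)) has_derivative (\<lambda>v. - (inverse (\<Phi> x) * fderiv \<Phi> x v * inverse (\<Phi> x)))) (at x)"
    by (rule Deriv.has_derivative_inverse[OF _ Cinf_onD[OF \<Phi>_smooth x]]) (use \<Phi>_pos[of x] in simp)
  ultimately have "(r has_derivative (\<lambda>v. inverse (\<Phi> x) *\<^sub>R incl v +
      (- (inverse (\<Phi> x) * fderiv \<Phi> x v * inverse (\<Phi> x))) *\<^sub>R lift x)) (at x)"
    unfolding r_def[abs_def] by (intro has_derivative_scaleR)
  from fderiv_eq[OF this] show ?thesis
    by (simp add: power2_eq_square field_simps)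
qed

text \<open>The conormal relations express that the tangent function agrees with \<open>\<Phi>\<close> to first order at the
point of tangency, and \<open>dw \<bullet> dr\<close> turns out to be \<open>D\<^sup>2\<Phi> / \<Phi>\<close>.\<close>

lemma conormal_pair_U: "conormal_pair U r w"
proof
  fix x v assume x: "x \<in> U"
  have \<Phi>0: "\<Phi> x \<noteq> 0" using \<Phi>_pos[of x] by simp
  show "w x \<bullet> r x = 1" using w_self[of x] \<Phi>0 by (simp add: r_def)
  show "w x \<bullet> fderiv r x v = 0"
    using \<Phi>0 by (simp add: fderiv_r[OF x] inner_diff_right w_incl[OF x] w_self power2_eq_square field_simps)
  have "fderiv w x v \<bullet> lift x = 0"
    using fderiv_w_lift[OF x, of v x] linear_0[OF has_derivative_linear[OF Cinf_onD[OF \<Phi>_smooth]]]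
      fderiv_cong[OF open_U _ Cinf_on_const[OF open_U] x, of "0::real" "\<lambda>z. fderiv \<Phi> z 0" v]
      fderiv_eq[OF has_derivative_const[of "0::real"]] by simp
  moreover have "fderiv w x v \<bullet> lift (x + v) = fderiv (\<lambda>z. fderiv \<Phi> z v) x v"
    using fderiv_w_lift[OF x, of v "x + v"] by simp
  ultimately have "fderiv w x v \<bullet> fderiv r x v = inverse (\<Phi> x) * fderiv (\<lambda>z. fderiv \<Phi> z v) x v"
    by (simp add: fderiv_r[OF x] inner_diff_right lift_add inner_add_right)
  then show "fderiv w x v \<bullet> fderiv r x v < 0" if "v \<noteq> 0"
    using hess_neg[OF x that] \<Phi>_pos[of x] by (simp add: mult_pos_neg)
qed (rule card_eq open_U r_smooth w_smooth)+

text \<open>\<open>1 + d\<phi>(x - x')\<close> is the value at \<open>x\<close> of the function tangent to \<open>\<Phi>\<close> at \<open>x'\<close>, divided by \<open>\<Phi> x'\<close>. Its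
positivity, needed to split the logarithm, holds because the tangent lies above \<open>\<Phi> > 0\<close>.\<close>

lemma L_divergence_eq:
  assumes x: "x \<in> U" and x': "x' \<in> U"
  shows "L_divergence \<phi> (lift x) (lift x') = ln (w x' \<bullet> r x)" "w x' \<bullet> r x > 0"
proof -
  let ?f = "\<lambda>x. \<phi> (lift x)"
  have D: "fderiv \<Phi> x' v = \<Phi> x' * fderiv ?f x' v" for v
  proof -
    have "(\<Phi> has_derivative (\<lambda>v. \<Phi> x' * fderiv ?f x' v)) (at x')"
      unfolding \<Phi>_def[abs_def] using has_derivative_exp[OF Cinf_onD[OF \<phi>_smooth x']] by (simp add: mult.commute)
    then show ?thesis using fderiv_eq by metis
  qed
  have "dir_deriv \<phi> (lift x') (lift x - lift x') = fderiv ?f x' (x - x')"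
    using lift_eq[of x x'] dir_deriv_eq[OF Cinf_onD[OF \<phi>_smooth x']] by (simp add: dir_deriv_lift)
  moreover have M: "w x' \<bullet> r x = (1 + fderiv ?f x' (x - x')) * (\<Phi> x' / \<Phi> x)"
    using w_tangent[OF x', of x] \<Phi>_pos[of x] by (simp add: r_def D field_simps)
  show pos: "w x' \<bullet> r x > 0"
    using w_lift_pos[OF x' x] \<Phi>_pos[of x] by (simp add: r_def)
  have "1 + fderiv ?f x' (x - x') > 0"
    using pos \<Phi>_pos[of x] \<Phi>_pos[of x'] unfolding M
    by (metis divide_pos_pos zero_less_mult_pos2)
  then have "ln (w x' \<bullet> r x) = ln (1 + fderiv ?f x' (x - x')) + (?f x' - ?f x)"
    unfolding M using \<Phi>_pos[of x] \<Phi>_pos[of x'] by (simp add: ln_mult ln_div) (simp add: \<Phi>_def)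
  ultimately show "L_divergence \<phi> (lift x) (lift x') = ln (w x' \<bullet> r x)"
    unfolding L_divergence_def by simp
qed

lemma conormal_divergence_coordinates:
  fixes \<xi> :: "real^'n \<Rightarrow> real^'m"
  assumes \<xi>: "coordinate_system \<xi>"
  defines "V \<equiv> \<xi> ` open_simplex" and "h \<equiv> \<lambda>x. proj (inv_into open_simplex \<xi> x)"
  shows "conormal_divergence V (\<lambda>x. r (h x)) (\<lambda>x. w (h x)) \<phi> \<xi>"
proof -
  have V: "V = \<xi> ` open_simplex" by (simp add: V_def)
  have op: "open V" and s: "smooth_on open_simplex \<xi>"
    "smooth_on V (inv_into open_simplex \<xi>)"
    using \<xi> unfolding coordinate_system_def V by blast+
  have inv: "inv_into open_simplex \<xi> x \<in> open_simplex" if "x \<in> V" for x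
    using that unfolding V by (rule inv_into_into)
  have hU: "h x \<in> U" and lh: "lift (h x) = inv_into open_simplex \<xi> x" if "x \<in> V" for x
    using inv[OF that] proj_image lift_proj_simplex by (auto simp: h_def)
  have h: "Cinf_on V h"
    unfolding h_def using s(2) smooth_on_open_iff[OF op] Cinf_on_linear[OF proj_linear op] by blast
  have \<xi>_lift: "Cinf_on U (\<lambda>y. \<xi> (lift y))"
    by (rule smooth_on_compose_Cinf_on[OF s(1) open_U lift_smooth[OF open_U]]) (auto simp: U_def)
  have nonsing: "v = 0" if x: "x \<in> V" and v: "fderiv h x v = 0" for x v
  proof -
    have "v = fderiv (\<lambda>x. x) x v" using fderiv_eq[OF has_derivative_ident] by metis
    also have "\<dots> = fderiv (\<lambda>x. \<xi> (lift (h x))) x v"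
      by (rule fderiv_cong[OF op _ _ x])
        (use lh f_inv_into_f[of _ \<xi> open_simplex] Cinf_on_compose[OF op \<xi>_lift h] hU in \<open>auto simp: V\<close>)
    also have "\<dots> = fderiv (\<lambda>y. \<xi> (lift y)) (h x) (fderiv h x v)"
      by (rule fderiv_compose[OF \<xi>_lift h x hU[OF x]])
    also have "\<dots> = 0"
      unfolding v by (rule linear_0[OF has_derivative_linear[OF Cinf_onD[OF \<xi>_lift hU[OF x]]]])
    finally show ?thesis .
  qed
  interpret U: conormal_pair U r w by (rule conormal_pair_U)
  have hV: "h ` V \<subseteq> U" using hU by blast
  interpret conormal_pair V "\<lambda>x. r (h x)" "\<lambda>x. w (h x)"
    using U.pullback[OF op h hV] nonsing .
  show ?thesis
  proof
    fix x x' assume x: "x \<in> V" "x' \<in> V"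
    show "0 < w (h x') \<bullet> r (h x)"
      using L_divergence_eq(2)[OF hU[OF x(1)] hU[OF x(2)]] .
    show "coord_divergence \<phi> \<xi> x x' = ln (w (h x') \<bullet> r (h x))"
      using L_divergence_eq(1)[OF hU[OF x(1)] hU[OF x(2)]] lh x by (simp add: coord_divergence_def)
  qed
qed

lemma incl_inj: "inj incl" using proj_incl by (metis injI)

text \<open>The projection of \<open>r = q / \<Phi>\<close> to the hyperplane of coordinate sum 1 is \<open>q\<close> itself, so the geodesics
are straight in any affine chart of the simplex.\<close>

lemma primal_projectively_flat:
  "projectively_flat (primal_connection \<phi> :: ('n, 'm) connection)"
proof -
  have inv: "inv_into open_simplex proj x = lift x" if "x \<in> U" for x
    using lift_in_simplex[OF that] lift_proj_simplex
    by (metis proj_lift inj_onI inv_into_f_f)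
  have inj: "inj_on proj open_simplex" using lift_proj_simplex by (metis inj_onI)
  have coord: "coordinate_system proj"
    unfolding coordinate_system_def proj_image
  proof (intro conjI inj open_U)
    show "smooth_on open_simplex proj"
      by (rule Cinf_on_imp_smooth_on[OF open_UNIV subset_UNIV Cinf_on_bounded_linear[OF proj_linear open_UNIV]])
    show "smooth_on U (inv_into open_simplex proj)"
      unfolding smooth_on_open_iff[OF open_U]
      by (rule Cinf_on_cong[OF open_U _ lift_smooth[OF open_U]]) (simp add: inv)
  qed
  define h where "h x = proj (inv_into open_simplex proj x)" for x
  interpret conormal_divergence U "\<lambda>x. r (h x)" "\<lambda>x. w (h x)" \<phi> proj
    using conormal_divergence_coordinates[OF coord] unfolding proj_image h_def .
  have cone: "r (h x) = (\<Sum>a\<in>UNIV. r (h x) $ a) *\<^sub>R (axis apex 1 + incl x)" if "x \<in> U" for x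
  proof -
    have "h x = x" by (simp add: h_def inv[OF that])
    moreover have "(\<Sum>a\<in>UNIV. r x $ a) = inverse (\<Phi> x)"
      by (simp add: r_def sum_lift flip: sum_distrib_left)
    ultimately show ?thesis by (simp add: r_def lift_def)
  qed
  have "straight_up_to_time J \<gamma>" if "geodesic (proj ` open_simplex) (primal_connection \<phi> proj) J \<gamma>" for J \<gamma>
    by (rule geodesic_straight[OF geodesic_cong[OF primal_connection_eq] cone incl_linear incl_inj])
      (use that in \<open>simp_all add: proj_image\<close>)
  then show ?thesis unfolding projectively_flat_def using coord by blast
qed

text \<open>The coordinates are the projection \<open>F\<close> of \<open>w\<close> to the hyperplane of coordinate sum 1. If \<open>F x = F y\<close>,
the tangent functions at \<open>x\<close> and \<open>y\<close> are proportional; as each lies strictly below the other at its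
own point of tangency, \<open>x = y\<close>. Likewise \<open>dF v = 0\<close> makes \<open>dw v\<close> a multiple of \<open>w\<close>, and pairing with
\<open>r\<close> shows that the multiple is zero.\<close>

lemma dual_projectively_flat:
  "projectively_flat (dual_connection \<phi> :: ('n, 'm) connection)"
proof -
  interpret U: conormal_pair U r w by (rule conormal_pair_U)
  define \<omega> where "\<omega> x = (\<Sum>a\<in>UNIV. w x $ a)" for x
  define F where "F x = proj (inverse (\<omega> x) *\<^sub>R w x)" for x
  have \<omega>_pos: "\<omega> x > 0" if x: "x \<in> U" for x
  proof -
    \<comment> \<open>\<open>\<omega> x / n\<close> is the value of the tangent function at the barycentre, which is positive\<close>
    define b :: "real^'n" where "b = (\<chi> a. 1 / CARD('n))"
    have b: "b \<in> open_simplex" by (simp add: b_def open_simplex_def)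
    then have "proj b \<in> U" using proj_image by blast
    then have "w x \<bullet> lift (proj b) > 0" by (rule w_lift_pos[OF x])
    then have "w x \<bullet> b > 0" by (simp add: lift_proj_simplex[OF b])
    moreover have "w x \<bullet> b = \<omega> x / CARD('n)"
      by (simp add: inner_vec_def b_def \<omega>_def sum_divide_distrib)
    ultimately show ?thesis by (simp add: zero_less_divide_iff)
  qed
  have \<omega>_smooth: "Cinf_on U \<omega>"
    unfolding \<omega>_def[abs_def]
    by (intro Cinf_on_sum open_U Cinf_on_linear[OF bounded_linear_vec_nth] w_smooth)
  have F_smooth: "Cinf_on U F"
    unfolding F_def[abs_def] using \<omega>_pos
    by (intro Cinf_on_linear[OF proj_linear] Cinf_on_scaleR Cinf_on_inverse open_U \<omega>_smooth w_smooth) force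
  have lift_F: "w x = \<omega> x *\<^sub>R lift (F x)" if "x \<in> U" for x
  proof -
    have "(\<Sum>a\<in>UNIV. (inverse (\<omega> x) *\<^sub>R w x) $ a) = 1"
      using \<omega>_pos[OF that] by (simp add: \<omega>_def flip: sum_distrib_left)
    then show ?thesis using \<omega>_pos[OF that] by (simp add: F_def lift_proj)
  qed
  have F_inj: "inj_on F U"
  proof (rule inj_onI, rule ccontr)
    fix x y assume xy: "x \<in> U" "y \<in> U" "F x = F y" "x \<noteq> y"
    have *: "\<omega> x < \<omega> y" if "x \<in> U" "y \<in> U" "F x = F y" "x \<noteq> y" for x y
    proof -
      have "w x \<bullet> lift x < w y \<bullet> lift x" using below_tangent[of y x] w_self[of x] that by simp
      then have "\<omega> x * (lift (F y) \<bullet> lift x) < \<omega> y * (lift (F y) \<bullet> lift x)"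
        using lift_F[OF that(1)] lift_F[OF that(2)] that(3) by (metis inner_scaleR_left)
      moreover have "lift (F y) \<bullet> lift x > 0"
        using w_lift_pos[OF that(2,1)] \<omega>_pos[OF that(2)] lift_F[OF that(2)]
        by (metis inner_scaleR_left zero_less_mult_pos)
      ultimately show ?thesis by simp
    qed
    show False using *[of x y] *[of y x] xy by simp
  qed
  have nonsing: "v = 0" if x: "x \<in> U" and v: "fderiv F x v = 0" for x v
  proof -
    have LF: "((\<lambda>y. lift (F y)) has_derivative (\<lambda>v. incl (fderiv F x v))) (at x)"
      unfolding lift_def using has_derivative_add[OF has_derivative_const
          bounded_linear.has_derivative[OF incl_bounded_linear Cinf_onD[OF F_smooth x]]] by simp
    have "((\<lambda>y. \<omega> y *\<^sub>R lift (F y)) has_derivative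
        (\<lambda>v. \<omega> x *\<^sub>R incl (fderiv F x v) + fderiv \<omega> x v *\<^sub>R lift (F x))) (at x)"
      by (rule has_derivative_scaleR[OF Cinf_onD[OF \<omega>_smooth x] LF])
    then have "(w has_derivative (\<lambda>v. \<omega> x *\<^sub>R incl (fderiv F x v) + fderiv \<omega> x v *\<^sub>R lift (F x))) (at x)"
      by (rule has_derivative_transform_within_open[OF _ open_U x]) (simp add: lift_F)
    then have dw: "fderiv w x v = fderiv \<omega> x v *\<^sub>R lift (F x)"
      by (simp add: fderiv_eq v linear_0[OF incl_linear])
    have "lift (F x) \<bullet> r x \<noteq> 0"
      using U.pair[OF x] lift_F[OF x] by (metis inner_scaleR_left mult_zero_right zero_neq_one)
    then have "fderiv w x v = 0" using U.conormal'[OF x, of v] dw by simp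
    then show "v = 0" using U.neg[OF x, of v] by force
  qed
  define V where "V = F ` U"
  have openV: "open V" and G_smooth: "Cinf_on V (inv_into U F)"
    using Cinf_on_inv_into[OF open_U F_smooth F_inj nonsing] by (simp_all add: V_def)
  define \<xi> where "\<xi> p = F (proj p)" for p
  have inj: "inj_on \<xi> open_simplex"
  proof (rule inj_onI)
    fix p q assume pq: "p \<in> open_simplex" "q \<in> open_simplex" "\<xi> p = \<xi> q"
    then have "proj p \<in> U" "proj q \<in> U" using proj_image by blast+
    then have "proj p = proj q" using F_inj pq(3) by (simp add: \<xi>_def inj_on_def)
    then show "p = q" using lift_proj_simplex pq(1,2) by metis
  qed
  have im: "\<xi> ` open_simplex = V" unfolding \<xi>_def V_def proj_image[symmetric] by (simp add: image_image)
  have inv: "inv_into open_simplex \<xi> x = lift (inv_into U F x)" if x: "x \<in> V" for x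
  proof -
    obtain y where y: "y \<in> U" "x = F y" using x by (auto simp: V_def)
    have "\<xi> (lift y) = x" using y by (simp add: \<xi>_def)
    then have "inv_into open_simplex \<xi> x = lift y"
      using inv_into_f_f[OF inj lift_in_simplex[OF y(1)]] by simp
    moreover have "inv_into U F x = y" using y inv_into_f_f[OF F_inj] by simp
    ultimately show ?thesis by simp
  qed
  have coord: "coordinate_system \<xi>"
    unfolding coordinate_system_def im
  proof (intro conjI inj openV)
    have op: "open (proj -` U)"
      using open_vimage[OF open_U] linear_continuous_on[OF proj_linear] by blast
    have \<xi>_smooth: "Cinf_on (proj -` U) \<xi>"
      unfolding \<xi>_def[abs_def] by (rule Cinf_on_compose[OF op F_smooth Cinf_on_bounded_linear[OF proj_linear op]]) auto
    show "smooth_on open_simplex \<xi>"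
      by (rule Cinf_on_imp_smooth_on[OF op _ \<xi>_smooth]) (use proj_image in auto)
    have "Cinf_on V (\<lambda>x. lift (inv_into U F x))"
      by (rule Cinf_on_compose[OF openV lift_smooth[OF open_UNIV] G_smooth]) simp
    then show "smooth_on V (inv_into open_simplex \<xi>)"
      unfolding smooth_on_open_iff[OF openV] by (rule Cinf_on_cong[OF openV, rotated]) (simp add: inv)
  qed
  define h where "h x = proj (inv_into open_simplex \<xi> x)" for x
  interpret primal: conormal_divergence V "\<lambda>x. r (h x)" "\<lambda>x. w (h x)" \<phi> \<xi>
    using conormal_divergence_coordinates[OF coord] unfolding im h_def .
  interpret dual: conormal_pair V "\<lambda>x. w (h x)" "\<lambda>x. r (h x)" by (rule primal.swap)
  have cone: "w (h x) = (\<Sum>a\<in>UNIV. w (h x) $ a) *\<^sub>R (axis apex 1 + incl x)" if "x \<in> V" for x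
  proof -
    have "h x = inv_into U F x" by (simp add: h_def inv[OF that])
    then have "h x \<in> U" "F (h x) = x"
      using that inv_into_into[of x F U] f_inv_into_f[of x F U] by (auto simp: V_def)
    then show ?thesis using lift_F[of "h x"] by (simp add: \<omega>_def lift_def)
  qed
  have "straight_up_to_time J \<gamma>" if "geodesic (\<xi> ` open_simplex) (dual_connection \<phi> \<xi>) J \<gamma>" for J \<gamma>
    by (rule dual.geodesic_straight[OF geodesic_cong[OF primal.dual_connection_eq] cone incl_linear incl_inj])
      (use that in \<open>simp_all add: im\<close>)
  then show ?thesis unfolding projectively_flat_def using coord by blast
qed

lemma not_flat:
  fixes \<xi> :: "real^'n \<Rightarrow> real^'m"
  assumes "coordinate_system \<xi>" "CARD('n) \<ge> 3"
  shows "\<not> curvature_vanishes (\<xi> ` open_simplex) (primal_connection \<phi> \<xi>)"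
    and "\<not> curvature_vanishes (\<xi> ` open_simplex) (dual_connection \<phi> \<xi>)"
proof -
  define h where "h x = proj (inv_into open_simplex \<xi> x)" for x
  interpret primal: conormal_divergence "\<xi> ` open_simplex" "\<lambda>x. r (h x)" "\<lambda>x. w (h x)" \<phi> \<xi>
    using conormal_divergence_coordinates[OF assms(1)] unfolding h_def .
  interpret dual: conormal_pair "\<xi> ` open_simplex" "\<lambda>x. w (h x)" "\<lambda>x. r (h x)" by (rule primal.swap)
  have m: "CARD('m) \<ge> 2" using assms(2) card_eq by simp
  have "(\<chi> a. 1 / CARD('n)) \<in> (open_simplex :: (real^'n) set)" by (simp add: open_simplex_def)
  then have ne: "\<xi> ` open_simplex \<noteq> {}" by blast
  show "\<not> curvature_vanishes (\<xi> ` open_simplex) (primal_connection \<phi> \<xi>)"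
    by (rule primal.not_curvature_vanishes[OF primal.primal_connection_eq ne m])
  show "\<not> curvature_vanishes (\<xi> ` open_simplex) (dual_connection \<phi> \<xi>)"
    by (rule dual.not_curvature_vanishes[OF primal.dual_connection_eq ne m])
qed

end

section \<open>Dual projective flatness\<close>

theorem corollary5p4:
  fixes \<phi> :: "real^'n \<Rightarrow> real"
  assumes "CARD('n) \<ge> 2"
    and "CARD('n) = CARD('m::finite) + 1"
    and "smooth_on open_simplex \<phi>"
    and "exponentially_concave \<phi>"
    and "hessian_negative_definite (\<lambda>p. exp (\<phi> p))"
  shows "dually_projectively_flat (L_metric \<phi> :: ('n, 'm) metric_field)
           (primal_connection \<phi>) (dual_connection \<phi>) \<and>
         (CARD('n) \<ge> 3 \<longrightarrow>
           (\<forall>\<xi> :: real^'n \<Rightarrow> real^'m. coordinate_system \<xi> \<longrightarrow>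
              \<not> curvature_vanishes (\<xi> ` open_simplex) (primal_connection \<phi> \<xi>) \<and>
              \<not> curvature_vanishes (\<xi> ` open_simplex) (dual_connection \<phi> \<xi>)))"
proof -
  \<comment> \<open>the vertex whose coordinate is omitted is arbitrary\<close>
  define apex :: 'n where "apex = undefined"
  have "card (UNIV - {apex}) = CARD('m)" using assms(2) by (simp add: card_Diff_singleton)
  then obtain e :: "'m \<Rightarrow> 'n" where "bij_betw e UNIV (UNIV - {apex})"
    using finite_same_card_bij[of "UNIV :: 'm set" "UNIV - {apex}"] by auto
  then interpret simplex_potential e apex \<phi>
    using assms(3,5) by unfold_locales
  show ?thesis
    using primal_projectively_flat dual_projectively_flat not_flat
    unfolding dually_projectively_flat_def by blast
qed

end
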